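(* Let $S=k[x_1,\ldots,x_n]$ be a polynomial ring over a field $k$ and $q\ge 2$. Let $I\subset S$ be a completely squarefree lexsegment ideal generated in degree $q$, determined by the monomials $u=x_1x_F$ (with $F\subset\{2,\ldots,n\}$, $|F|=q-1$) and $v=x_{j_1}\cdots x_{j_q}$, $2\leq j_1<\cdots<j_q\leq n$. For $1\le t\le q$ let $A_t=[j_t]\setminus\{j_1,\ldots,j_{t-1}\}$. Then the minimal primary decomposition of $I$ is the following. If $x_2\nmid u$, then $$I=\bigcap_{t:\,|A_t|\leq n-q}P_{A_t}\ \cap\bigcap_{\substack{t:\,|A_t|=n-q+1,\\ u/x_1\geq_{lex}v/x_{j_t}}}P_{A_t}\ \cap\bigcap_{\substack{G\subset[n],\ |G|=q-1,\\ G\cap A_t\neq\emptyset\ \forall t,\ u/x_1\geq_{lex}x_G}}P_{G^c}\ \cap\bigcap_{\substack{P\in\mathrm{Min}((L^f(u))),\\ \mathrm{height}\,P=n-q}}P,$$ and otherwise (if $x_2\mid u$) $$I=\bigcap_{t:\,|A_t|\leq n-q}P_{A_t}\ \cap\bigcap_{\substack{t:\,|A_t|=n-q+1,\\ u/x_1\geq_{lex}v/x_{j_t}}}P_{A_t}\ \cap\bigcap_{\substack{G\subset[n]\setminus\{1\},\ |G|=q-1,\\ G\cap A_t\neq\emptyset\ \forall t,\ u/x_1\geq_{lex}x_G}}P_{G^c}\ \cap\bigcap_{\substack{G\subset[n]\setminus\{1\},\ |G|=n-q+1,\\ x_{G\setminus\{\min(G)\}}\geq_{lex}x_{F^c\setminus\{1\}}}}P_G\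 \cap\bigcap_{\substack{P\in\mathrm{Min}((L^f(u))),\\ \mathrm{height}\,P=n-q}}P.$$
   Context: Monomials are ordered by the lexicographic order with $x_1>x_2>\cdots>x_n$. $\mathrm{Mon}^s_q(S)$ is the set of squarefree monomials of degree $q$ in $S$. For $u\geq_{lex}v$ in $\mathrm{Mon}^s_q(S)$, $L(u,v)=\{w\in\mathrm{Mon}^s_q(S):u\geq_{lex}w\geq_{lex}v\}$ is a squarefree lexsegment set, determining the ideal $(L(u,v))$; $L^f(u)=\{w\in\mathrm{Mon}^s_q(S):u\geq_{lex}w\}$. The squarefree shadow of a set $L$ of squarefree monomials is $\{x_iw: w\in L,\ x_i\nmid w,\ 1\le i\le n\}$; $L(u,v)$ is a completely squarefree lexsegment (and $(L(u,v))$ a completely squarefree lexsegment ideal) if all its iterated squarefree shadows are squarefree lexsegment sets. $[m]=\{1,\ldots,m\}$. For $G\subset[n]$: $x_G=\prod_{i\in G}x_i$, $P_G=(x_i:i\in G)$, $G^c=[n]\setminus G$. $\mathrm{Min}(J)$ is the set of minimal primes of the ideal $J$ in $S$. "Minimal primary decomposition" means an irredundant primary decomposition: the listed primes are exactly the minimal primes of $I$. *)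

theory Defs
  imports
    "HOL-Algebra.Ideal"
    "HOL-Library.Poly_Mapping"
    "HOL-Library.Extended_Nat"
begin

section \<open>The polynomial ring\<close>

text \<open>
  A monomial is its exponent vector, so products, quotients and divisibility of monomials are
  sums, differences and membership in \<open>keys\<close> of exponent vectors. The linear order on
  \<open>nat \<Rightarrow>\<^sub>0 nat\<close> from Poly_Mapping compares two vectors at the smallest
  index where they differ. It is therefore the lexicographic order with \<open>x\<^sub>1 > x\<^sub>2 > \<dots>\<close>,
  and \<open>w \<le> u\<close> below means \<open>u \<ge>\<^sub>l\<^sub>e\<^sub>x w\<close>.
\<close>

type_synonym mon = "nat \<Rightarrow>\<^sub>0 nat"

abbreviation X :: "nat \<Rightarrow> mon" where
  "X i \<equiv> Poly_Mapping.single i 1"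

definition mon_of_set :: "nat set \<Rightarrow> mon" where
  "mon_of_set G = (\<Sum>i\<in>G. X i)"

definition S :: "nat \<Rightarrow> (mon \<Rightarrow>\<^sub>0 'k::field) ring" where
  "S n = \<lparr>carrier = {p. \<forall>m\<in>Poly_Mapping.keys p. Poly_Mapping.keys m \<subseteq> {1..n}},
          mult = (*), one = 1, zero = 0, add = (+)\<rparr>"

abbreviation to_poly :: "mon \<Rightarrow> (mon \<Rightarrow>\<^sub>0 'k::field)" where
  "to_poly m \<equiv> Poly_Mapping.single m 1"

definition mon_ideal :: "nat \<Rightarrow> mon set \<Rightarrow> (mon \<Rightarrow>\<^sub>0 'k::field) set" where
  "mon_ideal n L = Idl\<^bsub>S n\<^esub> (to_poly ` L)"

definition P :: "nat \<Rightarrow> nat set \<Rightarrow> (mon \<Rightarrow>\<^sub>0 'k::field) set" where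
  "P n G = mon_ideal n (X ` G)"

lemma cring_S: "cring (S n :: (mon \<Rightarrow>\<^sub>0 'k::field) ring)"
proof (rule cringI)
  show "abelian_group (S n :: (mon \<Rightarrow>\<^sub>0 'k) ring)"
  proof (rule abelian_groupI)
    fix x y :: "mon \<Rightarrow>\<^sub>0 'k"
    assume "x \<in> carrier (S n)" and "y \<in> carrier (S n)"
    then show "x \<oplus>\<^bsub>S n\<^esub> y \<in> carrier (S n)"
      using Poly_Mapping.keys_add[of x y] by (auto simp: S_def)
  next
    fix x :: "mon \<Rightarrow>\<^sub>0 'k"
    assume x: "x \<in> carrier (S n)"
    have "Poly_Mapping.keys (- x) = Poly_Mapping.keys x"
      by (auto simp: in_keys_iff)
    with x show "\<exists>y\<in>carrier (S n). y \<oplus>\<^bsub>S n\<^esub> x = \<zero>\<^bsub>S n\<^esub>"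
      by (intro bexI[of _ "- x"]) (auto simp: S_def)
  qed (auto simp: S_def algebra_simps)
  show "Group.comm_monoid (S n :: (mon \<Rightarrow>\<^sub>0 'k) ring)"
  proof (rule comm_monoidI)
    fix x y :: "mon \<Rightarrow>\<^sub>0 'k"
    assume xy: "x \<in> carrier (S n)" "y \<in> carrier (S n)"
    have "Poly_Mapping.keys m \<subseteq> {1..n}" if m: "m \<in> Poly_Mapping.keys (x * y)" for m
    proof -
      obtain a b where "m = a + b" "a \<in> Poly_Mapping.keys x" "b \<in> Poly_Mapping.keys y"
        using m Poly_Mapping.keys_mult[of x y] by blast
      moreover from this xy have "Poly_Mapping.keys a \<subseteq> {1..n}" "Poly_Mapping.keys b \<subseteq> {1..n}"
        by (simp_all add: S_def)
      ultimately show ?thesis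
        using Poly_Mapping.keys_add[of a b] by blast
    qed
    then show "x \<otimes>\<^bsub>S n\<^esub> y \<in> carrier (S n)"
      by (simp add: S_def)
  qed (auto simp: S_def algebra_simps)
qed (auto simp: S_def algebra_simps)


section \<open>Primes, heights and primary decompositions\<close>

definition minimal_primes :: "('a, 'b) ring_scheme \<Rightarrow> 'a set \<Rightarrow> 'a set set" where
  "minimal_primes R J = {Q. primeideal Q R \<and> J \<subseteq> Q \<and>
     (\<forall>Q'. primeideal Q' R \<and> J \<subseteq> Q' \<and> Q' \<subseteq> Q \<longrightarrow> Q' = Q)}"

definition height :: "('a, 'b) ring_scheme \<Rightarrow> 'a set \<Rightarrow> enat" where
  "height R Q = Sup {enat h | h. \<exists>C. C h = Q \<and> (\<forall>i\<le>h. primeideal (C i) R) \<and>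
     (\<forall>i<h. C i \<subset> C (Suc i))}"

definition primary_ideal :: "'a set \<Rightarrow> ('a, 'b) ring_scheme \<Rightarrow> bool" where
  "primary_ideal Q R \<longleftrightarrow> cring R \<and> ideal Q R \<and> Q \<noteq> carrier R \<and>
     (\<forall>a\<in>carrier R. \<forall>b\<in>carrier R. a \<otimes>\<^bsub>R\<^esub> b \<in> Q \<longrightarrow>
        a \<in> Q \<or> (\<exists>m::nat. b [^]\<^bsub>R\<^esub> m \<in> Q))"

text \<open>The intersection with \<open>carrier R\<close> makes the empty intersection the whole ring.\<close>

definition irredundant_primary_decomposition ::
  "('a, 'b) ring_scheme \<Rightarrow> 'a set \<Rightarrow> 'a set set \<Rightarrow> bool" where
  "irredundant_primary_decomposition R I D \<longleftrightarrow>
     finite D \<and> (\<forall>Q\<in>D. primary_ideal Q R) \<and> I = carrier R \<inter> \<Inter>D \<and>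
     (\<forall>Q\<in>D. I \<noteq> carrier R \<inter> \<Inter>(D - {Q}))"

definition minimal_primary_decomposition ::
  "('a, 'b) ring_scheme \<Rightarrow> 'a set \<Rightarrow> 'a set set \<Rightarrow> bool" where
  "minimal_primary_decomposition R I D \<longleftrightarrow>
     irredundant_primary_decomposition R I D \<and> D = minimal_primes R I"


section \<open>Squarefree lexsegments\<close>

definition sqfree_mons :: "nat \<Rightarrow> nat \<Rightarrow> mon set" where
  "sqfree_mons n q = {w. Poly_Mapping.keys w \<subseteq> {1..n} \<and>
     (\<forall>i. Poly_Mapping.lookup w i \<le> 1) \<and>
     (\<Sum>i\<in>Poly_Mapping.keys w. Poly_Mapping.lookup w i) = q}"

definition lexseg :: "nat \<Rightarrow> nat \<Rightarrow> mon \<Rightarrow> mon \<Rightarrow> mon set" where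
  "lexseg n q u v = {w \<in> sqfree_mons n q. w \<le> u \<and> v \<le> w}"

definition final_lexseg :: "nat \<Rightarrow> nat \<Rightarrow> mon \<Rightarrow> mon set" where
  "final_lexseg n q u = {w \<in> sqfree_mons n q. w \<le> u}"

definition is_sqfree_lexseg :: "nat \<Rightarrow> nat \<Rightarrow> mon set \<Rightarrow> bool" where
  "is_sqfree_lexseg n q L \<longleftrightarrow>
     (\<exists>u\<in>sqfree_mons n q. \<exists>v\<in>sqfree_mons n q. v \<le> u \<and> L = lexseg n q u v)"

definition sqfree_shadow :: "nat \<Rightarrow> mon set \<Rightarrow> mon set" where
  "sqfree_shadow n L = {X i + w | i w. w \<in> L \<and> i \<in> {1..n} \<and> i \<notin> Poly_Mapping.keys w}"

text \<open>
  The \<open>i\<close>-th shadow of a set of degree \<open>q\<close> lives in degree \<open>q + i\<close>, and there are no squarefree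
  monomials in degrees above \<open>n\<close>; the bound on \<open>i\<close> only leaves out these empty shadows.
\<close>

definition completely_sqfree_lexseg :: "nat \<Rightarrow> nat \<Rightarrow> mon set \<Rightarrow> bool" where
  "completely_sqfree_lexseg n q L \<longleftrightarrow>
     (\<forall>i\<le>n - q. is_sqfree_lexseg n (q + i) ((sqfree_shadow n ^^ i) L))"

end

theory Submission
  imports Defs
begin

text \<open>
  Write \<open>L\<close> for the set of supports of the monomials in the lexsegment, a family of
  \<open>q\<close>-subsets of \<open>{1..n}\<close>. The proof has an algebraic and a combinatorial half.

  A squarefree monomial ideal is the intersection of the ideals \<open>P n G\<close> over the sets \<open>G\<close> that
  meet every support, and a prime containing the ideal contains one of these \<open>P n G\<close>. Hence the
  minimal primes are the \<open>P n G\<close> for the inclusion-minimal covers \<open>G\<close> of \<open>L\<close>, and they form an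
  irredundant primary decomposition (\<open>minimal_primary_decomposition_mon_ideal\<close>). The last family
  of the theorem also speaks of heights: \<open>P n G\<close> has height \<open>card G\<close> (\<open>height_P\<close>). The upper
  bound rests on two facts. More than \<open>n\<close> polynomials in \<open>n\<close> variables satisfy a polynomial
  relation, by counting monomials; and elements picked from the successive differences of a chain
  of primes satisfy none, because primality lets one cancel powers of these elements one after
  the other until a nonzero constant is left inside a prime.

  It remains to list the minimal covers of \<open>L\<close>, that is, the complements of the maximal sets \<open>C\<close>
  that contain no member of \<open>L\<close> (\<open>min_covers_cases\<close>). Completeness enters through the first
  shadow: every \<open>(q+1)\<close>-set containing \<open>1\<close> contains a member of \<open>L\<close>. So \<open>C\<close> has at most \<open>q\<close>
  elements if \<open>1 \<in> C\<close>.
  \<^item> If \<open>1 \<in> C\<close> and \<open>card C = q\<close>, then \<open>C\<close> lies strictly above the support of \<open>u\<close>: this is the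
    family of minimal primes of height \<open>n - q\<close> of the final lexsegment ideal.
  \<^item> If \<open>1 \<in> C\<close> and \<open>card C = q - 1\<close>, maximality says that already the smallest missing index
    turns \<open>C\<close> into a member of \<open>L\<close>. This needs \<open>2 \<in> F\<close>, and it is the family that occurs only
    when \<open>x\<^sub>2\<close> divides \<open>u\<close>.
  \<^item> If \<open>1 \<notin> C\<close> and \<open>card C \<ge> q\<close>, compare the smallest elements of \<open>C\<close> with the support of
    \<open>v\<close>: at the first \<open>t\<close> with \<open>j t \<notin> C\<close>, the set \<open>C\<close> must avoid \<open>A t\<close>. Since a set that avoids
    \<open>A t\<close> never contains a member of \<open>L\<close>, \<open>C\<close> is the complement of \<open>A t\<close>.
  \<^item> If \<open>1 \<notin> C\<close> and \<open>card C = q - 1\<close>, adding \<open>1\<close> shows that \<open>C\<close> is at most \<open>F\<close>. Either \<open>C\<close>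
    avoids some \<open>A t\<close> and is its complement, or \<open>C\<close> meets all of them, and then adding any index
    produces a member of \<open>L\<close> by the previous case.

  A maximal \<open>C\<close> with fewer than \<open>q - 1\<close> elements does not exist, since adding one element cannot
  produce a \<open>q\<close>-set.
\<close>


section \<open>The lexicographic order on sets of indices\<close>

text \<open>
  This is the lexicographic order of the squarefree monomials with these supports, see
  \<open>mon_of_set_less_iff\<close>. The witness \<open>c\<close> need not be the first difference: only inclusion is
  required below \<open>c\<close>, and an earlier difference is then also in favour of \<open>B\<close>. This makes the
  order easy to establish for sets that are known only up to enlargement.
\<close>

definition lex_less :: "nat set \<Rightarrow> nat set \<Rightarrow> bool" (infix "\<prec>" 50) where
  "A \<prec> B \<longleftrightarrow> (\<exists>c\<in>B - A. A \<inter> {..<c} \<subseteq> B)"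

abbreviation lex_le :: "nat set \<Rightarrow> nat set \<Rightarrow> bool" (infix "\<preceq>" 50) where
  "A \<preceq> B \<equiv> A \<prec> B \<or> A = B"

lemma lex_less_iff_first_difference:
  "A \<prec> B \<longleftrightarrow> (\<exists>c. c \<in> B \<and> c \<notin> A \<and> (\<forall>i<c. i \<in> A \<longleftrightarrow> i \<in> B))"
proof
  assume "A \<prec> B"
  then obtain c where c: "c \<in> B - A" "A \<inter> {..<c} \<subseteq> B"
    by (auto simp: lex_less_def)
  define d where "d = (LEAST d. d \<in> B - A)"
  have d: "d \<in> B - A" "d \<le> c"
    using LeastI[of "\<lambda>d. d \<in> B - A", OF c(1)] Least_le[of "\<lambda>d. d \<in> B - A", OF c(1)]
    by (auto simp: d_def)
  moreover have "i \<in> A" if "i < d" "i \<in> B" for i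
    using not_less_Least[of i "\<lambda>d. d \<in> B - A"] that by (auto simp: d_def)
  ultimately show "\<exists>c. c \<in> B \<and> c \<notin> A \<and> (\<forall>i<c. i \<in> A \<longleftrightarrow> i \<in> B)"
    using c by (intro exI[of _ d]) auto
qed (auto simp: lex_less_def)

lemma lex_less_linear: "A \<prec> B \<or> A = B \<or> B \<prec> A"
proof (cases "A = B")
  case False
  then have ex: "\<exists>d. (d \<in> A) \<noteq> (d \<in> B)"
    by auto
  define d where "d = (LEAST d. (d \<in> A) \<noteq> (d \<in> B))"
  have "(d \<in> A) \<noteq> (d \<in> B)"
    using LeastI_ex[OF ex] by (simp add: d_def)
  moreover have "i \<in> A \<longleftrightarrow> i \<in> B" if "i < d" for i
    using not_less_Least[of i "\<lambda>d. (d \<in> A) \<noteq> (d \<in> B)"] that by (auto simp: d_def)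
  ultimately show ?thesis
    unfolding lex_less_iff_first_difference by blast
qed simp

lemma lex_less_asym: "A \<prec> B \<Longrightarrow> \<not> B \<preceq> A"
  unfolding lex_less_iff_first_difference by (metis linorder_less_linear)

lemma lex_less_trans: "A \<prec> B \<Longrightarrow> B \<prec> C \<Longrightarrow> A \<prec> C"
  unfolding lex_less_iff_first_difference
  by (metis linorder_less_linear order.strict_trans)

lemma lex_less_Diff_iff:
  assumes "A \<subseteq> U" and "B \<subseteq> U"
  shows "U - A \<prec> U - B \<longleftrightarrow> B \<prec> A"
proof -
  have "(U - B) - (U - A) = A - B"
    using assms by auto
  moreover have "(U - A) \<inter> {..<c} \<subseteq> U - B \<longleftrightarrow> B \<inter> {..<c} \<subseteq> A" for c
    using assms by auto
  ultimately show ?thesis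
    by (simp add: lex_less_def)
qed

lemma lex_less_insert_iff:
  assumes "x \<notin> A" and "x \<notin> B"
  shows "insert x A \<prec> insert x B \<longleftrightarrow> A \<prec> B"
proof -
  have "insert x B - insert x A = B - A"
    using assms by auto
  moreover have "insert x A \<inter> {..<c} \<subseteq> insert x B \<longleftrightarrow> A \<inter> {..<c} \<subseteq> B" for c
    using assms by auto
  ultimately show ?thesis
    by (simp add: lex_less_def)
qed

lemma lex_le_interval:
  assumes "W \<subseteq> {a..}" and "finite W" and "card W = card {a..b}"
  shows "W \<preceq> {a..b}"
proof (cases "{a..b} \<subseteq> W")
  case True
  then show ?thesis
    using card_subset_eq[of W "{a..b}"] assms by simp
next
  case False
  then obtain c where "c \<in> {a..b} - W" by blast
  then show ?thesis
    using assms(1) unfolding lex_less_def by (intro disjI1 bexI[of _ c]) auto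
qed


section \<open>Minimal covers of a hypergraph\<close>

definition covers :: "nat set \<Rightarrow> nat set set \<Rightarrow> bool" where
  "covers G E \<longleftrightarrow> (\<forall>W\<in>E. W \<inter> G \<noteq> {})"

definition min_covers :: "nat \<Rightarrow> nat set set \<Rightarrow> nat set set" where
  "min_covers n E = {G. G \<subseteq> {1..n} \<and> covers G E \<and> (\<forall>H. H \<subset> G \<longrightarrow> \<not> covers H E)}"

lemma covers_iff_complement:
  assumes "E \<subseteq> Pow {1..n}"
  shows "covers G E \<longleftrightarrow> \<not> (\<exists>W\<in>E. W \<subseteq> {1..n} - G)"
proof -
  have "W \<inter> G \<noteq> {} \<longleftrightarrow> \<not> W \<subseteq> {1..n} - G" if "W \<in> E" for W
    using that assms by auto
  then show ?thesis
    by (simp add: covers_def)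
qed

text \<open>
  Covers are handled through their complements, the sets without an edge. For minimality it
  suffices to take away single vertices, because supersets of covers are covers.
\<close>

lemma min_covers_iff_complement:
  assumes "E \<subseteq> Pow {1..n}"
  shows "G \<in> min_covers n E \<longleftrightarrow> G \<subseteq> {1..n} \<and> \<not> (\<exists>W\<in>E. W \<subseteq> {1..n} - G) \<and>
    (\<forall>x\<in>G. \<exists>W\<in>E. W \<subseteq> insert x ({1..n} - G))" (is "_ = ?R")
proof
  assume G: "G \<in> min_covers n E"
  have "\<exists>W\<in>E. W \<subseteq> insert x ({1..n} - G)" if "x \<in> G" for x
  proof -
    have "\<not> covers (G - {x}) E"
      using G that by (auto simp: min_covers_def)
    then show ?thesis
      unfolding covers_iff_complement[OF assms] by blast
  qed
  with G show ?R
    by (auto simp: min_covers_def covers_iff_complement[OF assms])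
next
  assume R: ?R
  have "\<not> covers H E" if HG: "H \<subset> G" for H
  proof -
    obtain x where "x \<in> G" "x \<notin> H" using HG by auto
    moreover from this R have "insert x ({1..n} - G) \<subseteq> {1..n} - H"
      using HG by auto
    ultimately show ?thesis
      using R unfolding covers_iff_complement[OF assms] by (meson subset_trans)
  qed
  with R show "G \<in> min_covers n E"
    by (simp add: min_covers_def covers_iff_complement[OF assms])
qed

lemma min_covers_subset_eq:
  "G \<in> min_covers n E \<Longrightarrow> H \<subseteq> G \<Longrightarrow> covers H E \<Longrightarrow> G = H"
  by (auto simp: min_covers_def)

lemma cover_contains_min_cover:
  assumes "G \<subseteq> {1..n}" and "covers G E"
  shows "\<exists>H\<in>min_covers n E. H \<subseteq> G"
proof -
  have "finite G" using assms(1) finite_subset by blast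
  then show ?thesis
    using assms
  proof (induction G rule: finite_psubset_induct)
    case (psubset G)
    show ?case
    proof (cases "G \<in> min_covers n E")
      case False
      then obtain H where "H \<subset> G" "covers H E"
        using psubset.prems by (auto simp: min_covers_def)
      then show ?thesis
        using psubset.IH[of H] psubset.prems(1) by blast
    qed blast
  qed
qed

lemma min_covers_subset: "G \<in> min_covers n E \<Longrightarrow> G \<subseteq> {1..n}"
  by (simp add: min_covers_def)


section \<open>Squarefree monomial ideals and their minimal primes\<close>

lemma S_sel [simp]:
  "mult (S n) = (*)" "one (S n) = 1" "zero (S n) = 0" "add (S n) = (+)"
  by (simp_all add: S_def)

lemma carrier_S: "p \<in> carrier (S n) \<longleftrightarrow> (\<forall>m\<in>Poly_Mapping.keys p. Poly_Mapping.keys m \<subseteq> {1..n})"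
  by (simp add: S_def)

lemma carrier_S_mult: "p \<in> carrier (S n) \<Longrightarrow> r \<in> carrier (S n) \<Longrightarrow> p * r \<in> carrier (S n)"
  using monoid.m_closed[OF comm_monoid.axioms(1)[OF cring.axioms(2)[OF cring_S]], of p n r] by simp

lemma ideal_SI:
  fixes J :: "(mon \<Rightarrow>\<^sub>0 'k::field) set"
  assumes carrier: "J \<subseteq> carrier (S n)" and zero: "0 \<in> J"
    and add: "\<And>a b. a \<in> J \<Longrightarrow> b \<in> J \<Longrightarrow> a + b \<in> J"
    and mult: "\<And>a r. a \<in> J \<Longrightarrow> r \<in> carrier (S n) \<Longrightarrow> r * a \<in> J"
  shows "ideal J (S n)"
proof (rule idealI)
  interpret cring "S n :: (mon \<Rightarrow>\<^sub>0 'k) ring" by (rule cring_S)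
  show "ring (S n :: (mon \<Rightarrow>\<^sub>0 'k) ring)" by (rule ring_axioms)
  have neg: "\<ominus>\<^bsub>S n\<^esub> a \<in> J" if a: "a \<in> J" for a
  proof -
    have ac: "a \<in> carrier (S n)" using a carrier by auto
    have "- 1 \<in> carrier (S n :: (mon \<Rightarrow>\<^sub>0 'k) ring)"
      by (simp add: carrier_S)
    then have "- 1 * a \<in> J"
      using a mult by blast
    moreover have "- a \<in> carrier (S n)"
      using ac by (simp add: carrier_S in_keys_iff)
    then have "\<ominus>\<^bsub>S n\<^esub> a = - a"
      using ac by (intro minus_equality) auto
    ultimately show ?thesis by simp
  qed
  show "subgroup J (add_monoid (S n))"
    by (rule group.subgroupI[OF a_group])
      (use carrier zero add neg in \<open>auto simp: a_inv_def\<close>)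
qed (use mult in \<open>auto simp: mult.commute\<close>)

lemma ideal_S_D:
  assumes "ideal J (S n)"
  shows "J \<subseteq> carrier (S n)" "0 \<in> J" "\<And>a b. a \<in> J \<Longrightarrow> b \<in> J \<Longrightarrow> a + b \<in> J"
    "\<And>a r. a \<in> J \<Longrightarrow> r \<in> carrier (S n) \<Longrightarrow> r * a \<in> J"
proof -
  interpret ideal J "S n" by (rule assms)
  show "J \<subseteq> carrier (S n)" "0 \<in> J" "\<And>a b. a \<in> J \<Longrightarrow> b \<in> J \<Longrightarrow> a + b \<in> J"
    "\<And>a r. a \<in> J \<Longrightarrow> r \<in> carrier (S n) \<Longrightarrow> r * a \<in> J"
    using a_subset additive_subgroup.zero_closed[OF additive_subgroup_axioms]
      additive_subgroup.a_closed[OF additive_subgroup_axioms] I_l_closed by auto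
qed

lemma ideal_S_diff:
  assumes J: "ideal J (S n)" and "a \<in> J" "b \<in> J"
  shows "a - b \<in> J"
proof -
  have "- 1 * b \<in> J"
    using assms by (intro ideal_S_D(4)[OF J]) (auto simp: carrier_S)
  then show ?thesis
    using ideal_S_D(3)[OF J \<open>a \<in> J\<close>] by fastforce
qed

lemma ideal_S_sum:
  assumes J: "ideal J (S n)" and "\<And>x. x \<in> T \<Longrightarrow> f x \<in> J"
  shows "sum f T \<in> J"
  using assms(2) by (induction T rule: infinite_finite_induct) (auto intro: ideal_S_D[OF J])

lemma sum_singles_keys: "(\<Sum>m\<in>Poly_Mapping.keys p. Poly_Mapping.single m (Poly_Mapping.lookup p m)) = p"
  by (rule poly_mapping_eqI) (auto simp: lookup_sum lookup_single when_def not_in_keys_iff_lookup_eq_zero)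

lemma lookup_mon_of_set: "finite G \<Longrightarrow> Poly_Mapping.lookup (mon_of_set G) i = (if i \<in> G then 1 else 0)"
  by (simp add: mon_of_set_def lookup_sum lookup_single when_def)

lemma keys_mon_of_set [simp]: "finite G \<Longrightarrow> Poly_Mapping.keys (mon_of_set G) = G"
  by (auto simp: in_keys_iff lookup_mon_of_set split: if_splits)

lemma keys_add_mon: "Poly_Mapping.keys (a + b :: mon) = Poly_Mapping.keys a \<union> Poly_Mapping.keys b"
  by (auto simp: in_keys_iff lookup_add)

lemma mon_of_set_divides_iff:
  assumes "finite W"
  shows "(\<exists>d. m = mon_of_set W + d) \<longleftrightarrow> W \<subseteq> Poly_Mapping.keys m"
proof
  assume W: "W \<subseteq> Poly_Mapping.keys m"
  have "m = mon_of_set W + (m - mon_of_set W)"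
  proof (rule poly_mapping_eqI)
    fix i
    show "Poly_Mapping.lookup m i = Poly_Mapping.lookup (mon_of_set W + (m - mon_of_set W)) i"
      using W assms by (auto simp: lookup_add lookup_minus lookup_mon_of_set in_keys_iff subset_iff Suc_le_eq)
  qed
  then show "\<exists>d. m = mon_of_set W + d" ..
qed (use assms in \<open>auto simp: keys_add_mon\<close>)

text \<open>
  Membership is decided monomial by monomial: the right-hand side is an ideal containing the
  generators, and each of its elements is a sum of monomials divisible by a generator.
\<close>

lemma sqfree_ideal_eq:
  fixes E :: "nat set set"
  assumes E: "E \<subseteq> Pow {1..n}"
  shows "(mon_ideal n (mon_of_set ` E) :: (mon \<Rightarrow>\<^sub>0 'k::field) set) =
    {p \<in> carrier (S n). \<forall>m\<in>Poly_Mapping.keys p. \<exists>W\<in>E. W \<subseteq> Poly_Mapping.keys m}" (is "_ = ?J")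
proof -
  let ?R = "S n :: (mon \<Rightarrow>\<^sub>0 'k) ring"
  let ?M = "Idl\<^bsub>?R\<^esub> (to_poly ` mon_of_set ` E)"
  have fin: "finite W" if "W \<in> E" for W
    using that E finite_subset[of W "{1..n}"] by auto
  have idl: "ideal ?J (S n)"
  proof (rule ideal_SI)
    fix a b :: "mon \<Rightarrow>\<^sub>0 'k" assume ab: "a \<in> ?J" "b \<in> ?J"
    have "Poly_Mapping.keys (a + b) \<subseteq> Poly_Mapping.keys a \<union> Poly_Mapping.keys b"
      by (rule Poly_Mapping.keys_add)
    with ab show "a + b \<in> ?J"
      unfolding carrier_S mem_Collect_eq by blast
  next
    fix a r :: "mon \<Rightarrow>\<^sub>0 'k" assume a: "a \<in> ?J" and r: "r \<in> carrier (S n)"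
    have "\<exists>W\<in>E. W \<subseteq> Poly_Mapping.keys m" if "m \<in> Poly_Mapping.keys (r * a)" for m
    proof -
      obtain x y where "m = x + y" "y \<in> Poly_Mapping.keys a"
        using \<open>m \<in> _\<close> Poly_Mapping.keys_mult[of r a] by blast
      moreover from this a obtain W where "W \<in> E" "W \<subseteq> Poly_Mapping.keys y"
        by blast
      ultimately show ?thesis
        by (intro bexI[of _ W]) (auto simp: keys_add_mon)
    qed
    then show "r * a \<in> ?J"
      using a r carrier_S_mult by blast
  qed (auto simp: carrier_S)
  have gens: "to_poly ` mon_of_set ` E \<subseteq> ?J"
  proof
    fix p :: "mon \<Rightarrow>\<^sub>0 'k"
    assume "p \<in> to_poly ` mon_of_set ` E"
    then obtain W where W: "W \<in> E" "p = to_poly (mon_of_set W)" by blast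
    then have "W \<subseteq> {1..n}" using E by blast
    then show "p \<in> ?J"
      using W(1) fin[OF W(1)] by (auto simp: W(2) carrier_S)
  qed
  show ?thesis
    unfolding mon_ideal_def
  proof (rule equalityI)
    interpret cring "S n :: (mon \<Rightarrow>\<^sub>0 'k) ring" by (rule cring_S)
    show "?M \<subseteq> ?J"
      by (rule genideal_minimal[OF idl gens])
    have gens_c: "to_poly ` mon_of_set ` E \<subseteq> carrier ?R"
      by (rule subset_trans[OF gens]) simp
    have J: "ideal (?M) (S n)"
      by (rule genideal_ideal[OF gens_c])
    show "?J \<subseteq> ?M"
    proof
      fix p assume p: "p \<in> ?J"
      have "Poly_Mapping.single m (Poly_Mapping.lookup p m) \<in> ?M"
        if m: "m \<in> Poly_Mapping.keys p" for m
      proof -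
        obtain W where W: "W \<in> E" "W \<subseteq> Poly_Mapping.keys m"
          using p m by auto
        then obtain d where d: "m = mon_of_set W + d"
          using mon_of_set_divides_iff[OF fin[OF W(1)]] by blast
        have "Poly_Mapping.keys m \<subseteq> {1..n}"
          using p m by (simp add: carrier_S)
        then have "Poly_Mapping.single d (Poly_Mapping.lookup p m) \<in> carrier (S n)"
          using d by (auto simp: carrier_S keys_add_mon)
        moreover have "to_poly (mon_of_set W) \<in> ?M"
          using genideal_self[OF gens_c] W(1) by blast
        ultimately have "Poly_Mapping.single d (Poly_Mapping.lookup p m) * to_poly (mon_of_set W)
            \<in> ?M"
          by (rule ideal_S_D(4)[OF J, rotated])
        then show ?thesis
          using d by (simp add: mult_single add.commute)
      qed
      then have "(\<Sum>m\<in>Poly_Mapping.keys p. Poly_Mapping.single m (Poly_Mapping.lookup p m))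
          \<in> ?M"
        by (intro ideal_S_sum[OF J])
      then show "p \<in> ?M"
        unfolding sum_singles_keys .
    qed
  qed
qed

lemma P_eq:
  assumes "G \<subseteq> {1..n}"
  shows "(P n G :: (mon \<Rightarrow>\<^sub>0 'k::field) set) =
    {p \<in> carrier (S n). \<forall>m\<in>Poly_Mapping.keys p. Poly_Mapping.keys m \<inter> G \<noteq> {}}"
proof -
  have "X ` G = mon_of_set ` (\<lambda>i. {i}) ` G"
    by (auto simp: mon_of_set_def image_iff)
  moreover have "(\<lambda>i. {i}) ` G \<subseteq> Pow {1..n}"
    using assms by auto
  ultimately show ?thesis
    unfolding P_def by (simp only: sqfree_ideal_eq) auto
qed

lemma ideal_mon_ideal:
  assumes "\<And>w. w \<in> L \<Longrightarrow> Poly_Mapping.keys w \<subseteq> {1..n}"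
  shows "ideal (mon_ideal n L :: (mon \<Rightarrow>\<^sub>0 'k::field) set) (S n)"
  unfolding mon_ideal_def
  by (rule ring.genideal_ideal[OF cring.axioms(1)[OF cring_S]]) (use assms in \<open>auto simp: carrier_S\<close>)

lemma mon_ideal_subset_ideal:
  fixes J :: "(mon \<Rightarrow>\<^sub>0 'k::field) set"
  assumes "ideal J (S n)" and "to_poly ` L \<subseteq> J"
  shows "mon_ideal n L \<subseteq> J"
  unfolding mon_ideal_def
  by (rule ring.genideal_minimal[OF cring.axioms(1)[OF cring_S] assms])

lemma to_poly_X_mem_P_iff:
  assumes "G \<subseteq> {1..n}" and "i \<in> {1..n}"
  shows "(to_poly (X i) :: mon \<Rightarrow>\<^sub>0 'k::field) \<in> P n G \<longleftrightarrow> i \<in> G"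
  using assms by (auto simp: P_eq carrier_S)

text \<open>
  Modulo \<open>P n G\<close> only the monomials free of the variables in \<open>G\<close> survive. So it suffices to
  multiply these parts of two polynomials, and the full polynomial ring has no zero divisors.
\<close>

lemma primeideal_P:
  assumes G: "G \<subseteq> {1..n}"
  shows "primeideal (P n G :: (mon \<Rightarrow>\<^sub>0 'k::field) set) (S n)"
proof (rule primeidealI)
  show idl: "ideal (P n G :: (mon \<Rightarrow>\<^sub>0 'k) set) (S n)"
    unfolding P_def by (rule ideal_mon_ideal) (use G in auto)
  show "cring (S n :: (mon \<Rightarrow>\<^sub>0 'k) ring)" by (rule cring_S)
  have "(1 :: mon \<Rightarrow>\<^sub>0 'k) \<notin> P n G"
    by (simp add: P_eq[OF G])
  moreover have "(1 :: mon \<Rightarrow>\<^sub>0 'k) \<in> carrier (S n)"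
    by (simp add: carrier_S)
  ultimately show "carrier (S n) \<noteq> (P n G :: (mon \<Rightarrow>\<^sub>0 'k) set)"
    by blast
  fix a b :: "mon \<Rightarrow>\<^sub>0 'k"
  assume a: "a \<in> carrier (S n)" and b: "b \<in> carrier (S n)" and ab: "a \<otimes>\<^bsub>S n\<^esub> b \<in> P n G"
  define part :: "(mon \<Rightarrow>\<^sub>0 'k) \<Rightarrow> (mon \<Rightarrow>\<^sub>0 'k)" where
    "part = Poly_Mapping.mapp (\<lambda>m c. c when Poly_Mapping.keys m \<inter> G = {})"
  have lookup_part: "Poly_Mapping.lookup (part p) m =
      (Poly_Mapping.lookup p m when Poly_Mapping.keys m \<inter> G = {})" for p m
    by (auto simp: part_def lookup_mapp when_def in_keys_iff)
  have keys_part: "Poly_Mapping.keys (part p) = {m \<in> Poly_Mapping.keys p. Poly_Mapping.keys m \<inter> G = {}}" for p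
    by (intro Set.set_eqI) (simp add: in_keys_iff[of _ "part p"] in_keys_iff[of _ p] lookup_part conj_commute)
  have part_carrier: "part p \<in> carrier (S n)" if "p \<in> carrier (S n)" for p
    using that by (auto simp: carrier_S keys_part)
  have part_nonzero: "part p \<noteq> 0" if "p \<in> carrier (S n)" "p \<notin> P n G" for p
  proof -
    have "Poly_Mapping.keys (part p) \<noteq> {}"
      using that by (auto simp: P_eq[OF G] keys_part)
    then show ?thesis by auto
  qed
  have diff_part: "p - part p \<in> P n G" if "p \<in> carrier (S n)" for p
  proof -
    have "Poly_Mapping.keys (p - part p) = {m \<in> Poly_Mapping.keys p. Poly_Mapping.keys m \<inter> G \<noteq> {}}"
      by (intro Set.set_eqI)
        (simp add: in_keys_iff[of _ "p - part p"] in_keys_iff[of _ p] lookup_minus lookup_part when_def)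
    then show ?thesis
      using that by (auto simp: P_eq[OF G] carrier_S)
  qed
  show "a \<in> P n G \<or> b \<in> P n G"
  proof (rule ccontr)
    assume "\<not> ?thesis"
    then have "part a * part b \<noteq> 0"
      using part_nonzero a b by simp
    then obtain m where m: "m \<in> Poly_Mapping.keys (part a * part b)"
      by fastforce
    then obtain x y where "m = x + y" "x \<in> Poly_Mapping.keys (part a)" "y \<in> Poly_Mapping.keys (part b)"
      using Poly_Mapping.keys_mult[of "part a" "part b"] by blast
    then have "Poly_Mapping.keys m \<inter> G = {}"
      by (auto simp: keys_part keys_add_mon)
    then have "part a * part b \<notin> P n G"
      using m by (auto simp: P_eq[OF G])
    moreover have "part a * part b = a * b - (b * (a - part a) + part a * (b - part b))"
      by (simp add: algebra_simps)
    moreover have "b * (a - part a) + part a * (b - part b) \<in> P n G"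
      using a b part_carrier diff_part by (intro ideal_S_D(3,4)[OF idl]) auto
    ultimately show False
      using ideal_S_diff[OF idl] ab by simp
  qed
qed

lemma to_poly_mon_of_set_mem_prime:
  fixes Q :: "(mon \<Rightarrow>\<^sub>0 'k::field) set"
  assumes Q: "primeideal Q (S n)" and W: "W \<subseteq> {1..n}" and mem: "to_poly (mon_of_set W) \<in> Q"
  shows "\<exists>i\<in>W. to_poly (X i) \<in> Q"
proof -
  interpret primeideal Q "S n" by (rule Q)
  have "finite W" using W finite_subset by blast
  then show ?thesis
    using W mem
  proof (induction W)
    case empty
    have "1 \<in> Q"
      using empty by (simp add: mon_of_set_def)
    then have "carrier (S n) = Q"
      using one_imp_carrier by simp
    with I_notcarr show ?case by simp
  next
    case (insert i W)
    have "(to_poly (mon_of_set (insert i W)) :: mon \<Rightarrow>\<^sub>0 'k) = to_poly (X i) * to_poly (mon_of_set W)"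
      using insert.hyps by (simp add: mon_of_set_def mult_single)
    moreover have "(to_poly (X i) :: mon \<Rightarrow>\<^sub>0 'k) \<in> carrier (S n)"
      "(to_poly (mon_of_set W) :: mon \<Rightarrow>\<^sub>0 'k) \<in> carrier (S n)"
      using insert.prems insert.hyps by (auto simp: carrier_S)
    ultimately have "to_poly (X i) \<in> Q \<or> to_poly (mon_of_set W) \<in> Q"
      using I_prime insert.prems by simp
    then show ?case
      using insert by auto
  qed
qed

lemma P_subset_iff:
  assumes "G \<subseteq> {1..n}" and "H \<subseteq> {1..n}"
  shows "(P n G :: (mon \<Rightarrow>\<^sub>0 'k::field) set) \<subseteq> P n H \<longleftrightarrow> G \<subseteq> H"
proof
  assume sub: "(P n G :: (mon \<Rightarrow>\<^sub>0 'k) set) \<subseteq> P n H"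
  show "G \<subseteq> H"
  proof
    fix i assume "i \<in> G"
    have i: "i \<in> {1..n}"
      using \<open>i \<in> G\<close> assms(1) by blast
    then have "(to_poly (X i) :: mon \<Rightarrow>\<^sub>0 'k) \<in> P n G"
      using to_poly_X_mem_P_iff[OF assms(1)] \<open>i \<in> G\<close> by blast
    then show "i \<in> H"
      using i sub to_poly_X_mem_P_iff[OF assms(2)] by blast
  qed
next
  assume "G \<subseteq> H"
  then show "(P n G :: (mon \<Rightarrow>\<^sub>0 'k) set) \<subseteq> P n H"
    unfolding P_eq[OF assms(1)] P_eq[OF assms(2)] by blast
qed

lemma mon_ideal_subset_P_iff:
  assumes E: "E \<subseteq> Pow {1..n}" and G: "G \<subseteq> {1..n}"
  shows "(mon_ideal n (mon_of_set ` E) :: (mon \<Rightarrow>\<^sub>0 'k::field) set) \<subseteq> P n G \<longleftrightarrow> covers G E"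
proof
  assume sub: "(mon_ideal n (mon_of_set ` E) :: (mon \<Rightarrow>\<^sub>0 'k) set) \<subseteq> P n G"
  show "covers G E"
    unfolding covers_def
  proof
    fix W assume W: "W \<in> E"
    then have "finite W" "W \<subseteq> {1..n}"
      using E finite_subset[of W "{1..n}"] by auto
    then have "(to_poly (mon_of_set W) :: mon \<Rightarrow>\<^sub>0 'k) \<in> mon_ideal n (mon_of_set ` E)"
      using W by (auto simp: sqfree_ideal_eq[OF E] carrier_S)
    then show "W \<inter> G \<noteq> {}"
      using sub \<open>finite W\<close> by (auto simp: P_eq[OF G])
  qed
next
  assume cov: "covers G E"
  show "(mon_ideal n (mon_of_set ` E) :: (mon \<Rightarrow>\<^sub>0 'k) set) \<subseteq> P n G"
  proof
    fix p :: "mon \<Rightarrow>\<^sub>0 'k"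
    assume p: "p \<in> mon_ideal n (mon_of_set ` E)"
    have "Poly_Mapping.keys m \<inter> G \<noteq> {}" if "m \<in> Poly_Mapping.keys p" for m
    proof -
      obtain W where "W \<in> E" "W \<subseteq> Poly_Mapping.keys m"
        using p \<open>m \<in> _\<close> by (auto simp: sqfree_ideal_eq[OF E])
      then show ?thesis
        using cov by (auto simp: covers_def)
    qed
    then show "p \<in> P n G"
      using p by (auto simp: sqfree_ideal_eq[OF E] P_eq[OF G])
  qed
qed

text \<open>
  The variables contained in a prime \<open>Q\<close> form a cover, since a prime containing a product of
  variables contains one of them.
\<close>

lemma prime_contains_P_cover:
  fixes Q :: "(mon \<Rightarrow>\<^sub>0 'k::field) set"
  assumes E: "E \<subseteq> Pow {1..n}" and Q: "primeideal Q (S n)" and sub: "mon_ideal n (mon_of_set ` E) \<subseteq> Q"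
  shows "\<exists>G\<subseteq>{1..n}. covers G E \<and> P n G \<subseteq> Q"
proof -
  define G where "G = {i \<in> {1..n}. (to_poly (X i) :: mon \<Rightarrow>\<^sub>0 'k) \<in> Q}"
  have "covers G E"
    unfolding covers_def
  proof
    fix W assume W: "W \<in> E"
    then have W': "finite W" "W \<subseteq> {1..n}"
      using E finite_subset[of W "{1..n}"] by auto
    then have "(to_poly (mon_of_set W) :: mon \<Rightarrow>\<^sub>0 'k) \<in> mon_ideal n (mon_of_set ` E)"
      using W by (auto simp: sqfree_ideal_eq[OF E] carrier_S)
    then have "(to_poly (mon_of_set W) :: mon \<Rightarrow>\<^sub>0 'k) \<in> Q"
      using sub by blast
    then obtain i where "i \<in> W" "to_poly (X i) \<in> Q"
      using to_poly_mon_of_set_mem_prime[OF Q W'(2)] by blast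
    then have "i \<in> G"
      using W'(2) unfolding G_def by blast
    then show "W \<inter> G \<noteq> {}"
      using \<open>i \<in> W\<close> by blast
  qed
  moreover have "P n G \<subseteq> Q"
    unfolding P_def
    by (rule mon_ideal_subset_ideal[OF primeideal.axioms(1)[OF Q]]) (auto simp: G_def)
  moreover have "G \<subseteq> {1..n}"
    by (auto simp: G_def)
  ultimately show ?thesis
    by blast
qed

lemma minimal_primes_mon_ideal:
  assumes E: "E \<subseteq> Pow {1..n}"
  shows "minimal_primes (S n) (mon_ideal n (mon_of_set ` E) :: (mon \<Rightarrow>\<^sub>0 'k::field) set) = P n ` min_covers n E"
    (is "minimal_primes _ ?I = _")
proof (intro equalityI subsetI)
  fix Q assume "Q \<in> minimal_primes (S n) ?I"
  then have Q: "primeideal Q (S n)" "?I \<subseteq> Q"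
    and min: "\<And>Q'. primeideal Q' (S n) \<Longrightarrow> ?I \<subseteq> Q' \<Longrightarrow> Q' \<subseteq> Q \<Longrightarrow> Q' = Q"
    by (auto simp: minimal_primes_def)
  obtain G where G: "G \<subseteq> {1..n}" "covers G E" "P n G \<subseteq> Q"
    using prime_contains_P_cover[OF E Q] by blast
  then obtain H where H: "H \<in> min_covers n E" "H \<subseteq> G"
    using cover_contains_min_cover by blast
  have "P n H = Q"
  proof (rule min)
    show "primeideal (P n H :: (mon \<Rightarrow>\<^sub>0 'k) set) (S n)"
      by (rule primeideal_P[OF min_covers_subset[OF H(1)]])
    show "?I \<subseteq> P n H"
      using H(1) mon_ideal_subset_P_iff[OF E min_covers_subset[OF H(1)]] by (auto simp: min_covers_def)
    show "P n H \<subseteq> Q"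
      using P_subset_iff[OF min_covers_subset[OF H(1)] G(1)] H(2) G(3) by blast
  qed
  then show "Q \<in> P n ` min_covers n E"
    using H(1) by blast
next
  fix Q :: "(mon \<Rightarrow>\<^sub>0 'k) set"
  assume "Q \<in> P n ` min_covers n E"
  then obtain G where G: "G \<in> min_covers n E" "Q = P n G" by blast
  note G1 = min_covers_subset[OF G(1)]
  have "Q' = P n G" if Q': "primeideal Q' (S n)" "?I \<subseteq> Q'" "Q' \<subseteq> P n G" for Q'
  proof -
    obtain H where H: "H \<subseteq> {1..n}" "covers H E" "P n H \<subseteq> Q'"
      using prime_contains_P_cover[OF E Q'(1,2)] by blast
    then have "(P n H :: (mon \<Rightarrow>\<^sub>0 'k) set) \<subseteq> P n G"
      using Q'(3) by (rule_tac subset_trans)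
    then have "H \<subseteq> G"
      using P_subset_iff[OF H(1) G1] by blast
    then have "G = H"
      using min_covers_subset_eq[OF G(1)] H(2) by blast
    then show ?thesis
      using H(3) Q'(3) by blast
  qed
  moreover have "?I \<subseteq> P n G"
    using G(1) mon_ideal_subset_P_iff[OF E G1] by (auto simp: min_covers_def)
  ultimately show "Q \<in> minimal_primes (S n) ?I"
    unfolding minimal_primes_def G(2) using primeideal_P[OF G1] by blast
qed

lemma primary_if_prime: "primeideal Q R \<Longrightarrow> primary_ideal Q R"
  unfolding primary_ideal_def
proof (intro conjI ballI impI)
  assume Q: "primeideal Q R"
  then interpret primeideal Q R .
  show "cring R" "ideal Q R" by unfold_locales
  show "Q \<noteq> carrier R" using I_notcarr by blast
  fix a b assume "a \<in> carrier R" "b \<in> carrier R" "a \<otimes>\<^bsub>R\<^esub> b \<in> Q"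
  then have "a \<in> Q \<or> b \<in> Q" by (rule I_prime)
  then show "a \<in> Q \<or> (\<exists>m::nat. b [^]\<^bsub>R\<^esub> m \<in> Q)"
    using \<open>b \<in> carrier R\<close> by (auto intro: exI[of _ "Suc 0"])
qed

text \<open>
  For the intersection: if no edge divides a monomial \<open>m\<close>, the indices outside \<open>m\<close> form a cover
  \<open>G\<close> with \<open>m \<notin> P n G\<close>. For irredundancy: the product of the variables outside a minimal cover
  \<open>G\<close> lies in every other \<open>P n H\<close> but not in \<open>P n G\<close>.
\<close>

theorem minimal_primary_decomposition_mon_ideal:
  assumes E: "E \<subseteq> Pow {1..n}"
  shows "minimal_primary_decomposition (S n)
    (mon_ideal n (mon_of_set ` E) :: (mon \<Rightarrow>\<^sub>0 'k::field) set) (P n ` min_covers n E)"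
    (is "minimal_primary_decomposition _ ?I ?D")
proof -
  have "finite (min_covers n E)"
    by (rule finite_subset[of _ "Pow {1..n}"]) (auto simp: min_covers_def)
  moreover have "\<forall>Q\<in>?D. primary_ideal Q (S n)"
    using primary_if_prime primeideal_P min_covers_subset by blast
  moreover have "?I = carrier (S n) \<inter> \<Inter>?D"
  proof (intro equalityI subsetI)
    fix p assume p: "p \<in> ?I"
    then have "p \<in> carrier (S n)"
      by (simp add: sqfree_ideal_eq[OF E])
    moreover have "p \<in> P n G" if "G \<in> min_covers n E" for G
      using p that mon_ideal_subset_P_iff[OF E min_covers_subset[OF that], where ?'k = 'k]
      by (auto simp: min_covers_def)
    ultimately show "p \<in> carrier (S n) \<inter> \<Inter>?D" by blast
  next
    fix p :: "mon \<Rightarrow>\<^sub>0 'k"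
    assume p: "p \<in> carrier (S n) \<inter> \<Inter>?D"
    have "\<exists>W\<in>E. W \<subseteq> Poly_Mapping.keys m" if m: "m \<in> Poly_Mapping.keys p" for m
    proof (rule ccontr)
      assume no: "\<not> ?thesis"
      have "Poly_Mapping.keys m \<subseteq> {1..n}"
        using p m by (simp add: carrier_S)
      then have "covers ({1..n} - Poly_Mapping.keys m) E"
        using no unfolding covers_iff_complement[OF E] by (simp add: double_diff)
      then obtain H where H: "H \<in> min_covers n E" "H \<subseteq> {1..n} - Poly_Mapping.keys m"
        using cover_contains_min_cover[of "{1..n} - Poly_Mapping.keys m"] by blast
      then have "p \<in> P n H" using p by blast
      then have "Poly_Mapping.keys m \<inter> H \<noteq> {}"
        using m P_eq[OF min_covers_subset[OF H(1)]] by blast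
      then show False using H(2) by blast
    qed
    then show "p \<in> ?I"
      using p by (simp add: sqfree_ideal_eq[OF E])
  qed
  moreover have "?I \<noteq> carrier (S n) \<inter> \<Inter>(?D - {Q})" if "Q \<in> ?D" for Q
  proof -
    obtain G where G: "G \<in> min_covers n E" "Q = P n G"
      using \<open>Q \<in> ?D\<close> by blast
    note G1 = min_covers_subset[OF G(1)]
    define p :: "mon \<Rightarrow>\<^sub>0 'k" where "p = to_poly (mon_of_set ({1..n} - G))"
    have keys_p: "Poly_Mapping.keys p = {mon_of_set ({1..n} - G)}"
      by (simp add: p_def)
    have pc: "p \<in> carrier (S n)"
      by (simp add: carrier_S keys_p)
    have "p \<in> P n H" if H: "H \<in> min_covers n E" "P n H \<noteq> Q" for H
    proof -
      have "\<not> H \<subseteq> G"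
        using H G(2) min_covers_subset_eq[OF G(1), of H] by (auto simp: min_covers_def)
      then show ?thesis
        unfolding P_eq[OF min_covers_subset[OF H(1)]]
        using pc keys_p min_covers_subset[OF H(1)] by auto
    qed
    then have "p \<in> carrier (S n) \<inter> \<Inter>(?D - {Q})"
      using pc by blast
    moreover have "p \<notin> P n G"
      unfolding P_eq[OF G1] using keys_p by auto
    moreover have "?I \<subseteq> P n G"
      using G(1) mon_ideal_subset_P_iff[OF E G1] by (auto simp: min_covers_def)
    ultimately show ?thesis by blast
  qed
  ultimately show ?thesis
    unfolding minimal_primary_decomposition_def irredundant_primary_decomposition_def
      minimal_primes_mon_ideal[OF E] by blast
qed


section \<open>Heights of monomial primes\<close>

definition power_product :: "'a::comm_monoid_mult list \<Rightarrow> nat list \<Rightarrow> 'a" where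
  "power_product fs es = prod_list (map2 (^) fs es)"

lemma power_product_simps [simp]:
  "power_product [] es = 1"
  "power_product (f # fs) (e # es) = f ^ e * power_product fs es"
  by (simp_all add: power_product_def)

lemma one_mem_carrier_S: "1 \<in> carrier (S n)"
  by (simp add: carrier_S)

lemma const_mem_carrier_S: "Poly_Mapping.single 0 c \<in> carrier (S n)"
  by (simp add: carrier_S)

lemma carrier_S_add: "p \<in> carrier (S n) \<Longrightarrow> r \<in> carrier (S n) \<Longrightarrow> p + r \<in> carrier (S n)"
  using abelian_monoid.a_closed[OF abelian_group.axioms(1)[OF ring.axioms(1)[OF cring.axioms(1)[OF cring_S]]], of p n r]
  by simp

lemma carrier_S_power: "p \<in> carrier (S n) \<Longrightarrow> p ^ e \<in> carrier (S n)"
  by (induction e) (auto intro: carrier_S_mult one_mem_carrier_S)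

lemma carrier_S_sum: "(\<And>x. x \<in> T \<Longrightarrow> f x \<in> carrier (S n)) \<Longrightarrow> sum f T \<in> carrier (S n)"
  by (induction T rule: infinite_finite_induct) (auto intro: carrier_S_add simp: carrier_S[of 0])

lemma carrier_S_power_product:
  assumes "set fs \<subseteq> carrier (S n)" and "length es = length fs"
  shows "power_product fs es \<in> carrier (S n)"
  using assms(2,1)
  by (induction es fs rule: list_induct2) (auto intro: carrier_S_mult carrier_S_power one_mem_carrier_S)

lemma prime_S_not_one:
  assumes "primeideal Q (S n)"
  shows "1 \<notin> Q"
proof
  interpret primeideal Q "S n" by (rule assms)
  assume "1 \<in> Q"
  then have "carrier (S n) = Q" using one_imp_carrier by simp
  with I_notcarr show False by simp
qed

lemma prime_S_power_notin:
  assumes Q: "primeideal Q (S n)" and f: "f \<in> carrier (S n)" "f \<notin> Q"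
  shows "f ^ m \<notin> Q"
proof (induction m)
  case 0
  show ?case using prime_S_not_one[OF Q] by simp
next
  case (Suc m)
  interpret primeideal Q "S n" by (rule Q)
  show ?case
    using Suc I_prime[of f "f ^ m"] f carrier_S_power[OF f(1)] by auto
qed

text \<open>
  Elements picked from the successive differences of a chain of primes satisfy no relation, not
  even modulo the smallest prime. Take out the least power \<open>f\<^sup>m\<close> of the first element \<open>f\<close>: the sum
  becomes \<open>f\<^sup>m (T + f R)\<close>, where \<open>T\<close> is a relation between the remaining elements. If this lies in
  \<open>C 0\<close>, so does \<open>T + f R\<close>, hence \<open>T \<in> C 1\<close> because \<open>f \<in> C 1\<close>, and the chain starting
  at \<open>C 1\<close> is shorter.
\<close>

lemma prime_chain_no_relation:
  fixes fs :: "(mon \<Rightarrow>\<^sub>0 'k::field) list" and C :: "nat \<Rightarrow> (mon \<Rightarrow>\<^sub>0 'k) set"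
  assumes "\<And>i. i \<le> length fs \<Longrightarrow> primeideal (C i) (S n)"
    and "\<And>i. i < length fs \<Longrightarrow> C i \<subseteq> C (Suc i)"
    and "\<And>i. i < length fs \<Longrightarrow> fs ! i \<in> C (Suc i) - C i"
    and "finite E" "E \<noteq> {}" "\<And>e. e \<in> E \<Longrightarrow> length e = length fs \<and> c e \<noteq> 0"
  shows "(\<Sum>e\<in>E. Poly_Mapping.single 0 (c e) * power_product fs e) \<notin> C 0"
  using assms
proof (induction fs arbitrary: C E c)
  case Nil
  then have E: "E = {[]}" by auto
  have C0: "primeideal (C 0) (S n)" using Nil.prems(1) by simp
  have c: "c [] \<noteq> 0" using Nil.prems(6) E by simp
  show ?case
  proof
    assume "(\<Sum>e\<in>E. Poly_Mapping.single 0 (c e) * power_product [] e) \<in> C 0"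
    then have "Poly_Mapping.single 0 (c []) \<in> C 0" by (simp add: E)
    then have "Poly_Mapping.single 0 (inverse (c [])) * Poly_Mapping.single 0 (c []) \<in> C 0"
      by (rule ideal_S_D(4)[OF primeideal.axioms(1)[OF C0] _ const_mem_carrier_S])
    then have "1 \<in> C 0"
      using c by (simp add: mult_single)
    then show False
      using prime_S_not_one[OF C0] by simp
  qed
next
  case (Cons f gs)
  have C0: "primeideal (C 0) (S n)" and C1: "primeideal (C 1) (S n)"
    using Cons.prems(1)[of 0] Cons.prems(1)[of 1] by auto
  have C01: "C 0 \<subseteq> C 1" using Cons.prems(2)[of 0] by simp
  have f: "f \<in> C 1" "f \<notin> C 0" using Cons.prems(3)[of 0] by auto
  have fc: "f \<in> carrier (S n)"
    using f(1) ideal_S_D(1)[OF primeideal.axioms(1)[OF C1]] by blast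
  have gs: "set gs \<subseteq> carrier (S n)"
  proof
    fix g assume "g \<in> set gs"
    then obtain i where i: "i < length gs" "g = gs ! i" by (auto simp: in_set_conv_nth)
    then have "g \<in> C (Suc (Suc i))" using Cons.prems(3)[of "Suc i"] by auto
    moreover have "primeideal (C (Suc (Suc i))) (S n)"
      using Cons.prems(1) i by simp
    ultimately show "g \<in> carrier (S n)"
      using ideal_S_D(1)[OF primeideal.axioms(1)] by blast
  qed
  have lenE: "length (tl e) = length gs" "e = hd e # tl e" if "e \<in> E" for e
  proof -
    have "length e = Suc (length gs)" using Cons.prems(6) that by simp
    then show "length (tl e) = length gs" "e = hd e # tl e" by (auto simp: length_Suc_conv)
  qed
  define m where "m = Min (hd ` E)"
  have m_le: "m \<le> hd e" if "e \<in> E" for e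
    using that Cons.prems(4) by (simp add: m_def)
  \<comment> \<open>The exponents of \<open>f\<close> in \<open>E - E0\<close> exceed \<open>m\<close>, so a further factor \<open>f\<close> splits off there.\<close>
  define E0 where "E0 = {e \<in> E. hd e = m}"
  have "m \<in> hd ` E"
    unfolding m_def using Cons.prems(4,5) by (intro Min_in) auto
  then have "E0 \<noteq> {}" by (auto simp: E0_def)
  define R where "R = (\<Sum>e\<in>E - E0. Poly_Mapping.single 0 (c e) * (f ^ (hd e - Suc m) * power_product gs (tl e)))"
  define T where "T = (\<Sum>t\<in>tl ` E0. Poly_Mapping.single 0 (c (m # t)) * power_product gs t)"
  have Rc: "R \<in> carrier (S n)"
    unfolding R_def
    by (intro carrier_S_sum carrier_S_mult carrier_S_power carrier_S_power_product const_mem_carrier_S fc gs)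
      (use lenE in auto)
  have Tc: "T \<in> carrier (S n)"
    unfolding T_def
    by (intro carrier_S_sum carrier_S_mult carrier_S_power_product const_mem_carrier_S gs)
      (use lenE in \<open>auto simp: E0_def\<close>)
  have inj: "inj_on tl E0"
    by (rule inj_onI) (metis (mono_tags, lifting) E0_def lenE(2) mem_Collect_eq)
  have "f ^ m * T = (\<Sum>e\<in>E0. Poly_Mapping.single 0 (c e) * power_product (f # gs) e)"
  proof -
    have "f ^ m * T = (\<Sum>e\<in>E0. f ^ m * (Poly_Mapping.single 0 (c (m # tl e)) * power_product gs (tl e)))"
      unfolding T_def by (simp add: sum.reindex[OF inj] sum_distrib_left)
    also have "\<dots> = (\<Sum>e\<in>E0. Poly_Mapping.single 0 (c e) * power_product (f # gs) e)"
    proof (rule sum.cong[OF refl])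
      fix e assume "e \<in> E0"
      then have "e = m # tl e" using lenE(2)[of e] by (simp add: E0_def)
      then show "f ^ m * (Poly_Mapping.single 0 (c (m # tl e)) * power_product gs (tl e)) =
          Poly_Mapping.single 0 (c e) * power_product (f # gs) e"
        by (metis mult.left_commute power_product_simps(2))
    qed
    finally show ?thesis .
  qed
  moreover have "f ^ m * (f * R) = (\<Sum>e\<in>E - E0. Poly_Mapping.single 0 (c e) * power_product (f # gs) e)"
    unfolding R_def sum_distrib_left
  proof (rule sum.cong[OF refl])
    fix e assume e: "e \<in> E - E0"
    then have "hd e = m + Suc (hd e - Suc m)"
      using m_le[of e] by (auto simp: E0_def)
    then have "f ^ hd e = f ^ m * (f * f ^ (hd e - Suc m))"
      by (metis power_add power_Suc)
    moreover have "power_product (f # gs) e = f ^ hd e * power_product gs (tl e)"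
      using lenE(2)[of e] e by (metis DiffD1 power_product_simps(2))
    ultimately show "f ^ m * (f * (Poly_Mapping.single 0 (c e) * (f ^ (hd e - Suc m) * power_product gs (tl e)))) =
        Poly_Mapping.single 0 (c e) * power_product (f # gs) e"
      by (simp add: mult_ac)
  qed
  ultimately have sum_eq: "(\<Sum>e\<in>E. Poly_Mapping.single 0 (c e) * power_product (f # gs) e) = f ^ m * (T + f * R)"
    using sum.subset_diff[of E0 E "\<lambda>e. Poly_Mapping.single 0 (c e) * power_product (f # gs) e"] Cons.prems(4)
    by (auto simp: E0_def distrib_left add.commute)
  have "T \<notin> C 1"
  proof -
    have "(\<Sum>t\<in>tl ` E0. Poly_Mapping.single 0 (c (m # t)) * power_product gs t) \<notin> (C \<circ> Suc) 0"
    proof (rule Cons.IH)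
      fix t assume "t \<in> tl ` E0"
      then obtain e where e: "e \<in> E" "hd e = m" "t = tl e" by (auto simp: E0_def)
      then have "m # t = e" using lenE(2) by metis
      then show "length t = length gs \<and> c (m # t) \<noteq> 0"
        using Cons.prems(6)[OF e(1)] by auto
    next
      fix i assume "i < length gs"
      then show "gs ! i \<in> (C \<circ> Suc) (Suc i) - (C \<circ> Suc) i"
        using Cons.prems(3)[of "Suc i"] by simp
    qed (use Cons.prems(1,2,4) \<open>E0 \<noteq> {}\<close> in \<open>auto simp: E0_def\<close>)
    then show ?thesis by (simp add: T_def)
  qed
  show ?case
    unfolding sum_eq
  proof
    assume mem: "f ^ m * (T + f * R) \<in> C 0"
    interpret C0: primeideal "C 0" "S n" by (rule C0)
    have "T + f * R \<in> C 0"
      using C0.I_prime[of "f ^ m" "T + f * R"] mem prime_S_power_notin[OF C0 fc f(2)]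
        carrier_S_power[OF fc] carrier_S_add[OF Tc carrier_S_mult[OF fc Rc]] by auto
    then have "T + f * R \<in> C 1" using C01 by blast
    moreover have "R * f \<in> C 1"
      by (rule ideal_S_D(4)[OF primeideal.axioms(1)[OF C1] f(1) Rc])
    ultimately have "(T + f * R) - R * f \<in> C 1"
      by (rule ideal_S_diff[OF primeideal.axioms(1)[OF C1]])
    then show False
      using \<open>T \<notin> C 1\<close> by (simp add: mult.commute)
  qed
qed

interpretation poly_vs: vector_space "\<lambda>c (p :: mon \<Rightarrow>\<^sub>0 'k::field). Poly_Mapping.single 0 c * p"
  by unfold_locales (auto simp: algebra_simps single_add mult_single simp flip: mult.assoc)

definition exponents_le :: "(mon \<Rightarrow>\<^sub>0 'k::zero) \<Rightarrow> nat \<Rightarrow> bool" where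
  "exponents_le p d \<longleftrightarrow> (\<forall>m\<in>Poly_Mapping.keys p. \<forall>i. Poly_Mapping.lookup m i \<le> d)"

lemma exponents_le_mono: "exponents_le p d \<Longrightarrow> d \<le> d' \<Longrightarrow> exponents_le p d'"
  unfolding exponents_le_def by (meson le_trans)

lemma exponents_le_mult:
  assumes "exponents_le p d" and "exponents_le r e"
  shows "exponents_le (p * r) (d + e)"
  unfolding exponents_le_def
proof (intro ballI allI)
  fix m i assume "m \<in> Poly_Mapping.keys (p * r)"
  then obtain x y where "m = x + y" "x \<in> Poly_Mapping.keys p" "y \<in> Poly_Mapping.keys r"
    using Poly_Mapping.keys_mult[of p r] by blast
  then show "Poly_Mapping.lookup m i \<le> d + e"
    using assms by (simp add: exponents_le_def lookup_add add_mono)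
qed

lemma exponents_le_one: "exponents_le (1 :: mon \<Rightarrow>\<^sub>0 'k::zero_neq_one) 0"
  by (simp add: exponents_le_def)

lemma exponents_le_power:
  "exponents_le (p :: mon \<Rightarrow>\<^sub>0 'k::field) d \<Longrightarrow> exponents_le (p ^ e) (e * d)"
  by (induction e) (auto intro: exponents_le_mult exponents_le_one)

lemma exponents_le_power_product:
  fixes fs :: "(mon \<Rightarrow>\<^sub>0 'k::field) list"
  assumes "length es = length fs" and "\<And>f. f \<in> set fs \<Longrightarrow> exponents_le f d"
    and "\<And>e. e \<in> set es \<Longrightarrow> e \<le> N"
  shows "exponents_le (power_product fs es) (length fs * (N * d))"
  using assms
proof (induction es fs rule: list_induct2)
  case Nil
  then show ?case by (simp add: exponents_le_one)
next
  case (Cons e es f fs)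
  have "exponents_le (f ^ e) (N * d)"
    using Cons.prems by (intro exponents_le_mono[OF exponents_le_power[of f d e]] mult_right_mono) auto
  moreover have "exponents_le (power_product fs es) (length fs * (N * d))"
    using Cons by simp
  ultimately show ?case
    using exponents_le_mult by fastforce
qed

lemma exponents_le_exists: "\<exists>d. \<forall>f\<in>set fs. exponents_le f d"
proof -
  have one: "\<exists>d. exponents_le f d" for f :: "mon \<Rightarrow>\<^sub>0 'a"
  proof -
    let ?A = "\<Union>m\<in>Poly_Mapping.keys f. Poly_Mapping.range m"
    have fin: "finite ?A" by simp
    have "Poly_Mapping.lookup m i \<le> Max (insert 0 ?A)" if "m \<in> Poly_Mapping.keys f" for m i
    proof (cases "i \<in> Poly_Mapping.keys m")
      case True
      then have "Poly_Mapping.lookup m i \<in> ?A"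
        by (intro UN_I[OF that] in_keys_lookup_in_range)
      then show ?thesis by (intro Max_ge finite.insertI[OF fin] insertI2)
    qed (simp add: in_keys_iff)
    then show ?thesis
      unfolding exponents_le_def by blast
  qed
  show ?thesis
  proof (induction fs)
    case (Cons f fs)
    then obtain d where "\<forall>f\<in>set fs. exponents_le f d" by blast
    moreover obtain d' where "exponents_le f d'" using one by blast
    ultimately have "\<forall>g\<in>set (f # fs). exponents_le g (max d d')"
      by (auto intro: exponents_le_mono)
    then show ?case by blast
  qed simp
qed

definition box :: "nat \<Rightarrow> nat \<Rightarrow> mon set" where
  "box n D = {m. Poly_Mapping.keys m \<subseteq> {1..n} \<and> (\<forall>i. Poly_Mapping.lookup m i \<le> D)}"

lemma box_finite_card: "finite (box n D) \<and> card (box n D) \<le> (D + 1) ^ n"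
proof -
  let ?g = "\<lambda>m. restrict (Poly_Mapping.lookup m) {1..n}"
  have sub: "?g ` box n D \<subseteq> PiE {1..n} (\<lambda>_. {..D})"
    by (auto simp: box_def)
  have inj: "inj_on ?g (box n D)"
  proof (rule inj_onI)
    fix a b assume ab: "a \<in> box n D" "b \<in> box n D" "?g a = ?g b"
    show "a = b"
    proof (rule poly_mapping_eqI)
      fix i
      show "Poly_Mapping.lookup a i = Poly_Mapping.lookup b i"
      proof (cases "i \<in> {1..n}")
        case True
        then show ?thesis using fun_cong[OF ab(3), of i] by simp
      next
        case False
        then have "i \<notin> Poly_Mapping.keys a" "i \<notin> Poly_Mapping.keys b"
          using ab(1,2) by (auto simp: box_def)
        then show ?thesis by (simp add: in_keys_iff)
      qed
    qed
  qed
  have fin: "finite (PiE {1..n} (\<lambda>_. {..D}))"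
    by (intro finite_PiE) auto
  have "card (box n D) \<le> card (PiE {1..n} (\<lambda>_. {..D}))"
    by (rule card_inj_on_le[OF inj sub fin])
  also have "\<dots> = (D + 1) ^ n"
    by (simp add: card_PiE)
  finally show ?thesis
    using inj_on_finite[OF inj sub fin] by simp
qed

lemma span_monomials:
  assumes "Poly_Mapping.keys p \<subseteq> M"
  shows "p \<in> poly_vs.span (to_poly ` M)"
proof -
  have "(\<Sum>m\<in>Poly_Mapping.keys p. Poly_Mapping.single 0 (Poly_Mapping.lookup p m) * to_poly m) \<in> poly_vs.span (to_poly ` M)"
    using assms by (intro poly_vs.span_sum poly_vs.span_scale poly_vs.span_base) auto
  then show ?thesis
    by (simp add: mult_single sum_singles_keys)
qed

text \<open>
  The products of \<open>h = length fs\<close> polynomials with exponents below \<open>N\<close> are \<open>N\<^sup>h\<close> in number, but they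
  involve only \<open>O(N\<^sup>n)\<close> monomials. For large \<open>N\<close> they are therefore linearly dependent if \<open>h > n\<close>.
\<close>

lemma algebraic_dependence:
  fixes fs :: "(mon \<Rightarrow>\<^sub>0 'k::field) list"
  assumes fs: "set fs \<subseteq> carrier (S n)" and len: "n < length fs"
  shows "\<exists>E c. finite E \<and> E \<noteq> {} \<and> (\<forall>e\<in>E. length e = length fs \<and> c e \<noteq> (0::'k)) \<and>
    (\<Sum>e\<in>E. Poly_Mapping.single 0 (c e) * power_product fs e) = 0"
proof -
  let ?h = "length fs"
  obtain d where d: "\<And>f. f \<in> set fs \<Longrightarrow> exponents_le f d"
    using exponents_le_exists by blast
  \<comment> \<open>With \<open>M\<close> for \<open>?h * d + 1\<close>, at most \<open>(M * N) ^ n\<close> monomials occur, and \<open>N\<close> is chosen just above \<open>M ^ n\<close>.\<close>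
  define N where "N = (?h * d + 1) ^ n + 1"
  define Es where "Es = {es. set es \<subseteq> {..<N} \<and> length es = ?h}"
  have fin: "finite Es" and card_Es: "card Es = N ^ ?h"
    using finite_lists_length_eq[of "{..<N}" ?h] card_lists_length_eq[of "{..<N}" ?h]
    by (auto simp: Es_def)
  let ?B = "to_poly ` box n (?h * (N * d)) :: (mon \<Rightarrow>\<^sub>0 'k) set"
  have B: "finite ?B" "card ?B \<le> (?h * (N * d) + 1) ^ n"
    using box_finite_card[of n "?h * (N * d)"] card_image_le[of "box n (?h * (N * d))" to_poly]
    by (auto intro: le_trans)
  have span: "power_product fs ` Es \<subseteq> poly_vs.span ?B"
  proof
    fix p assume "p \<in> power_product fs ` Es"
    then obtain es where es: "set es \<subseteq> {..<N}" "length es = ?h" "p = power_product fs es"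
      by (auto simp: Es_def)
    have "exponents_le p (?h * (N * d))"
      unfolding es(3) using es by (intro exponents_le_power_product d) auto
    moreover have "p \<in> carrier (S n)"
      unfolding es(3) by (rule carrier_S_power_product[OF fs es(2)])
    ultimately have "Poly_Mapping.keys p \<subseteq> box n (?h * (N * d))"
      by (auto simp: box_def exponents_le_def carrier_S)
    then show "p \<in> poly_vs.span ?B"
      by (rule span_monomials)
  qed
  have big: "(?h * (N * d) + 1) ^ n < N ^ ?h"
  proof -
    have "?h * (N * d) + 1 \<le> (?h * d + 1) * N"
      by (simp add: N_def algebra_simps)
    then have "(?h * (N * d) + 1) ^ n \<le> (?h * d + 1) ^ n * N ^ n"
      using power_mono[of "?h * (N * d) + 1" "(?h * d + 1) * N" n] unfolding power_mult_distrib by simp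
    also have "\<dots> < N * N ^ n"
      by (rule mult_strict_right_mono) (auto simp: N_def)
    also have "\<dots> \<le> N ^ ?h"
      using len power_increasing[of "Suc n" ?h N] by (simp add: N_def)
    finally show ?thesis .
  qed
  show ?thesis
  proof (cases "inj_on (power_product fs) Es")
    case False
    then obtain a b where ab: "a \<in> Es" "b \<in> Es" "a \<noteq> b" "power_product fs a = power_product fs b"
      by (auto simp: inj_on_def)
    \<comment> \<open>Two equal products already form a relation.\<close>
    let ?c = "\<lambda>e. if e = a then 1 else - 1 :: 'k"
    have "(\<Sum>e\<in>{a, b}. Poly_Mapping.single 0 (?c e) * power_product fs e) = 0"
      using ab(3,4) by (simp add: single_uminus)
    then show ?thesis
      using ab by (intro exI[of _ "{a, b}"] exI[of _ ?c]) (auto simp: Es_def)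
  next
    case True
    have "poly_vs.dependent (power_product fs ` Es)"
    proof (rule ccontr)
      assume "\<not> ?thesis"
      then have "card (power_product fs ` Es) \<le> card ?B"
        using poly_vs.independent_span_bound[OF B(1) _ span] by blast
      then show False
        using B(2) big card_Es card_image[OF True] by simp
    qed
    then obtain w where w: "\<exists>v\<in>power_product fs ` Es. w v \<noteq> 0"
        "(\<Sum>v\<in>power_product fs ` Es. Poly_Mapping.single 0 (w v) * v) = 0"
      using poly_vs.dependent_finite[of "power_product fs ` Es"] fin by auto
    define E where "E = {e \<in> Es. w (power_product fs e) \<noteq> 0}"
    have "(\<Sum>e\<in>E. Poly_Mapping.single 0 (w (power_product fs e)) * power_product fs e) =
        (\<Sum>e\<in>Es. Poly_Mapping.single 0 (w (power_product fs e)) * power_product fs e)"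
      by (rule sum.mono_neutral_left[OF fin]) (auto simp: E_def)
    also have "\<dots> = 0"
      using w(2) by (simp add: sum.reindex[OF True])
    finally show ?thesis
      using w(1) finite_subset[OF _ fin, of E]
      by (intro exI[of _ E] exI[of _ "\<lambda>e. w (power_product fs e)"]) (auto simp: E_def Es_def)
  qed
qed

lemma prime_chain_length_le:
  fixes C :: "nat \<Rightarrow> (mon \<Rightarrow>\<^sub>0 'k::field) set"
  assumes prime: "\<And>i. i \<le> h \<Longrightarrow> primeideal (C i) (S n)"
    and strict: "\<And>i. i < h \<Longrightarrow> C i \<subset> C (Suc i)"
  shows "h \<le> n"
proof (rule ccontr)
  assume "\<not> h \<le> n"
  have "\<exists>f. f \<in> C (Suc i) - C i" if "i < h" for i
    using strict[OF that] by blast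
  then obtain f where f: "\<And>i. i < h \<Longrightarrow> f i \<in> C (Suc i) - C i"
    by metis
  define fs where "fs = map f [0..<h]"
  have "set fs \<subseteq> carrier (S n)"
  proof
    fix p assume "p \<in> set fs"
    then obtain i where "i < h" "p = f i" by (auto simp: fs_def)
    then show "p \<in> carrier (S n)"
      using f[of i] ideal_S_D(1)[OF primeideal.axioms(1)[OF prime[of "Suc i"]]] by auto
  qed
  moreover have "n < length fs"
    using \<open>\<not> h \<le> n\<close> by (simp add: fs_def)
  ultimately obtain E c where E: "finite E" "E \<noteq> {}"
      "\<And>e. e \<in> E \<Longrightarrow> length e = length fs \<and> c e \<noteq> (0::'k)"
      "(\<Sum>e\<in>E. Poly_Mapping.single 0 (c e) * power_product fs e) = 0"
    using algebraic_dependence[of fs n] by blast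
  have "(\<Sum>e\<in>E. Poly_Mapping.single 0 (c e) * power_product fs e) \<notin> C 0"
  proof (rule prime_chain_no_relation[OF _ _ _ E(1,2,3)])
    fix i
    show "i \<le> length fs \<Longrightarrow> primeideal (C i) (S n)"
      by (simp add: fs_def prime)
    show "i < length fs \<Longrightarrow> C i \<subseteq> C (Suc i)"
      using strict[of i] by (auto simp: fs_def)
    show "i < length fs \<Longrightarrow> fs ! i \<in> C (Suc i) - C i"
      using f[of i] by (simp add: fs_def)
  qed
  then show False
    using E(4) ideal_S_D(2)[OF primeideal.axioms(1)[OF prime[of 0]]] by simp
qed

lemma P_strict_chain:
  assumes "distinct xs" and "set xs \<inter> H = {}" and "H \<union> set xs \<subseteq> {1..n}" and "i < length xs"
  shows "(P n (H \<union> set (take i xs)) :: (mon \<Rightarrow>\<^sub>0 'k::field) set) \<subset> P n (H \<union> set (take (Suc i) xs))"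
proof -
  have "set (take (Suc i) xs) = insert (xs ! i) (set (take i xs))"
    using assms(4) by (simp add: take_Suc_conv_app_nth)
  moreover have "xs ! i \<notin> set (take i xs)"
    using assms(1,4) by (auto simp: in_set_conv_nth nth_eq_iff_index_eq)
  moreover have "xs ! i \<notin> H"
    using assms(2,4) nth_mem[of i xs] by blast
  ultimately have "\<not> H \<union> set (take (Suc i) xs) \<subseteq> H \<union> set (take i xs)"
      "H \<union> set (take i xs) \<subseteq> H \<union> set (take (Suc i) xs)"
    by auto
  moreover have "H \<union> set (take k xs) \<subseteq> {1..n}" for k
    using assms(3) set_take_subset[of k xs] by blast
  ultimately show ?thesis
    using P_subset_iff[where ?'k = 'k] by (simp add: less_le_not_le)
qed

text \<open>
  A chain of primes below \<open>P n G\<close> is continued by adding the other \<open>n - card G\<close> variables one by one,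
  and a chain has length at most \<open>n\<close>. Conversely, adding the variables in \<open>G\<close> one by one gives a
  chain of length \<open>card G\<close>.
\<close>

theorem height_P:
  assumes G: "G \<subseteq> {1..n}"
  shows "height (S n) (P n G :: (mon \<Rightarrow>\<^sub>0 'k::field) set) = enat (card G)"
proof (rule antisym)
  have fin: "finite G" using G finite_subset by blast
  show "height (S n) (P n G :: (mon \<Rightarrow>\<^sub>0 'k) set) \<le> enat (card G)"
    unfolding height_def
  proof (rule Sup_least, clarsimp)
    fix h and C :: "nat \<Rightarrow> (mon \<Rightarrow>\<^sub>0 'k) set"
    assume C: "C h = P n G" "\<forall>i\<le>h. primeideal (C i) (S n)" "\<forall>i<h. C i \<subset> C (Suc i)"
    define xs where "xs = sorted_list_of_set ({1..n} - G)"
    have xs: "set xs = {1..n} - G" "distinct xs" "length xs = n - card G"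
      using fin card_Diff_subset[OF fin G] by (simp_all add: xs_def)
    have card: "card G \<le> n" using card_mono[OF _ G] by simp
    define C' where "C' i = (if i \<le> h then C i else P n (G \<union> set (take (i - h) xs)))" for i
    have C'_ge: "C' i = P n (G \<union> set (take (i - h) xs))" if "h \<le> i" for i
      using that C(1) by (auto simp: C'_def)
    have "h + length xs \<le> n"
    proof (rule prime_chain_length_le[of _ C'])
      fix i
      show "primeideal (C' i) (S n)"
      proof (cases "i \<le> h")
        case False
        have "G \<union> set (take (i - h) xs) \<subseteq> {1..n}"
          using G xs(1) set_take_subset[of "i - h" xs] by blast
        then show ?thesis
          using False by (simp add: C'_def primeideal_P)
      qed (use C(2) in \<open>simp add: C'_def\<close>)
      assume i: "i < h + length xs"
      show "C' i \<subset> C' (Suc i)"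
      proof (cases "i < h")
        case False
        have "(P n (G \<union> set (take (i - h) xs)) :: (mon \<Rightarrow>\<^sub>0 'k) set) \<subset>
            P n (G \<union> set (take (Suc (i - h)) xs))"
          using xs G False i by (intro P_strict_chain) auto
        moreover have "Suc i - h = Suc (i - h)"
          using False by simp
        ultimately show ?thesis
          using False C'_ge[of i] C'_ge[of "Suc i"] by simp
      qed (use C(3) in \<open>simp add: C'_def\<close>)
    qed
    then show "h \<le> card G"
      using xs(3) card by simp
  qed
  define ys where "ys = sorted_list_of_set G"
  have ys: "set ys = G" "distinct ys" "length ys = card G"
    using fin by (simp_all add: ys_def)
  define C where "C i = (P n ({} \<union> set (take i ys)) :: (mon \<Rightarrow>\<^sub>0 'k) set)" for i
  have "C (card G) = P n G"
    using ys by (simp add: C_def)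
  moreover have "primeideal (C i) (S n)" for i
  proof -
    have "{} \<union> set (take i ys) \<subseteq> {1..n}"
      using G ys(1) set_take_subset[of i ys] by blast
    then show ?thesis
      unfolding C_def by (rule primeideal_P)
  qed
  moreover have "C i \<subset> C (Suc i)" if "i < card G" for i
    unfolding C_def using ys G that by (intro P_strict_chain) auto
  ultimately show "enat (card G) \<le> height (S n) (P n G :: (mon \<Rightarrow>\<^sub>0 'k) set)"
    unfolding height_def by (intro Sup_upper) blast
qed


section \<open>The minimal covers of a completely squarefree lexsegment\<close>

lemma subset_from_2:
  assumes "C \<subseteq> {1..n}" and "1 \<notin> C"
  shows "C \<subseteq> {2..n::nat}"
proof
  fix x assume "x \<in> C"
  with assms have "x \<in> {1..n}" "x \<noteq> 1" by auto
  then show "x \<in> {2..n}" by simp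
qed

text \<open>
  The sets \<open>U\<close> and \<open>V\<close> below are the supports of the end monomials \<open>u\<close> and \<open>v\<close>, and \<open>L\<close> and \<open>Lf\<close>
  consist of the supports of the lexsegment between them and of the final lexsegment of \<open>u\<close>.
\<close>

locale sqfree_lexsegment =
  fixes n q :: nat and F :: "nat set" and j :: "nat \<Rightarrow> nat"
  assumes q: "2 \<le> q"
    and F: "F \<subseteq> {2..n}" "card F = q - 1"
    and j: "strict_mono_on {1..q} j" "j ` {1..q} \<subseteq> {2..n}"
begin

definition V :: "nat set" where
  "V = j ` {1..q}"

definition U :: "nat set" where
  "U = insert 1 F"

definition L :: "nat set set" where
  "L = {W. W \<subseteq> {1..n} \<and> card W = q \<and> V \<preceq> W \<and> W \<preceq> U}"

definition Lf :: "nat set set" where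
  "Lf = {W. W \<subseteq> {1..n} \<and> card W = q \<and> W \<preceq> U}"

definition A :: "nat \<Rightarrow> nat set" where
  "A t = {1..j t} - j ` {1..<t}"

lemma j_less_iff: "s \<in> {1..q} \<Longrightarrow> t \<in> {1..q} \<Longrightarrow> j s < j t \<longleftrightarrow> s < t"
  using j(1) by (rule strict_mono_on_less)

lemma j_bounds: "t \<in> {1..q} \<Longrightarrow> 2 \<le> j t \<and> j t \<le> n"
  using j(2) by (meson atLeastAtMost_iff image_subset_iff)

lemma V: "V \<subseteq> {2..n}" "card V = q"
proof -
  show "V \<subseteq> {2..n}"
    using j(2) by (simp add: V_def)
  show "card V = q"
    using card_image[OF strict_mono_on_imp_inj_on[OF j(1)]] by (simp add: V_def)
qed

lemma q_less_n: "q < n"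
  using card_mono[OF _ V(1)] V(2) q by simp

lemma A_subset: "t \<in> {1..q} \<Longrightarrow> A t \<subseteq> {1..n}"
  using j_bounds[of t] by (auto simp: A_def)

lemma one_mem_A: "t \<in> {1..q} \<Longrightarrow> 1 \<in> A t"
proof -
  assume t: "t \<in> {1..q}"
  have "1 \<notin> j ` {1..<t}"
    using j_bounds t by force
  then show ?thesis
    using j_bounds[OF t] by (simp add: A_def)
qed

lemma j_mem_A_iff: "s \<in> {1..q} \<Longrightarrow> t \<in> {1..q} \<Longrightarrow> j s \<in> A t \<longleftrightarrow> s = t"
proof -
  assume st: "s \<in> {1..q}" "t \<in> {1..q}"
  have "j s \<in> j ` {1..<t} \<longleftrightarrow> s < t"
  proof
    assume "j s \<in> j ` {1..<t}"
    then obtain r where "r \<in> {1..<t}" "j s = j r" by auto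
    then show "s < t"
      using j_less_iff[of r s] j_less_iff[of s r] st by force
  qed (use st in auto)
  moreover have "j s \<le> j t \<longleftrightarrow> s \<le> t"
    using j_less_iff[of t s] st by force
  ultimately show ?thesis
    using j_bounds[of s] st by (auto simp: A_def)
qed

lemma A_inter_V: "t \<in> {1..q} \<Longrightarrow> A t \<inter> V = {j t}"
  using j_mem_A_iff by (auto simp: V_def)

lemma A_subset_A: "s \<in> {1..q} \<Longrightarrow> t \<in> {1..q} \<Longrightarrow> A s \<subseteq> A t \<Longrightarrow> s = t"
  using j_mem_A_iff[of s s] j_mem_A_iff[of s t] by auto

lemma L_subset: "L \<subseteq> Pow {1..n}"
  by (auto simp: L_def)

lemma less_if_one_mem: "1 \<in> W \<Longrightarrow> B \<subseteq> {2..n} \<Longrightarrow> B \<prec> W"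
  unfolding lex_less_def by (intro bexI[of _ 1]) auto

lemma less_U: "W \<subseteq> {2..n} \<Longrightarrow> W \<prec> U"
  by (rule less_if_one_mem) (simp add: U_def)

lemma insert_one_mem_L:
  assumes "C \<subseteq> {2..n}"
  shows "insert 1 C \<in> L \<longleftrightarrow> card C = q - 1 \<and> C \<preceq> F"
proof -
  have "finite C" "1 \<notin> C" "1 \<notin> F" "insert 1 C \<subseteq> {1..n}"
    using assms F(1) q_less_n finite_subset[OF assms] by auto
  moreover have "V \<prec> insert 1 C"
    using V(1) by (intro less_if_one_mem) auto
  moreover have "insert 1 C \<prec> U \<longleftrightarrow> C \<prec> F"
    using lex_less_insert_iff[OF \<open>1 \<notin> C\<close> \<open>1 \<notin> F\<close>] by (simp add: U_def)
  moreover have "insert 1 C = U \<longleftrightarrow> C = F"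
    using insert_ident[OF \<open>1 \<notin> C\<close> \<open>1 \<notin> F\<close>] by (simp add: U_def)
  moreover have "card (insert 1 C) = q \<longleftrightarrow> card C = q - 1"
    using \<open>finite C\<close> \<open>1 \<notin> C\<close> q by auto
  ultimately show ?thesis
    by (simp add: L_def)
qed

lemma mem_L_without_one:
  assumes "C \<subseteq> {2..n}"
  shows "C \<in> L \<longleftrightarrow> card C = q \<and> V \<preceq> C"
  using assms less_U[OF assms] by (auto simp: L_def)

lemma not_L_if_small:
  assumes "finite C" and "card C < q" and "W \<in> L"
  shows "\<not> W \<subseteq> C"
  using assms card_mono[of C W] by (auto simp: L_def)

lemma V_mem_L: "V \<in> L"
  using mem_L_without_one V by simp

text \<open>
  If \<open>W\<close> avoids \<open>A t\<close>, then up to \<open>j t\<close> it has only elements of \<open>V\<close> and misses \<open>j t\<close> itself, so it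
  lies strictly below \<open>V\<close>.
\<close>

lemma not_L_if_avoids_A:
  assumes t: "t \<in> {1..q}" and "C \<inter> A t = {}" and "W \<in> L"
  shows "\<not> W \<subseteq> C"
proof
  assume "W \<subseteq> C"
  then have WA: "W \<inter> A t = {}"
    using assms by auto
  have jt: "j t \<in> V" "j t \<in> A t"
    using A_inter_V[OF t] by auto
  from \<open>W \<in> L\<close> have W: "V \<preceq> W" "W \<subseteq> {1..n}"
    by (auto simp: L_def)
  with WA jt obtain c where c: "c \<in> W - V" "V \<inter> {..<c} \<subseteq> W"
    by (auto simp: lex_less_def)
  have "c \<notin> j ` {1..<t}"
    using c(1) t by (auto simp: V_def)
  then have "j t < c"
    using c W WA by (force simp: A_def)
  \<comment> \<open>The element \<open>j t\<close> of \<open>V\<close> lies below \<open>c\<close> and would have to be in \<open>W\<close>.\<close>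
  then show False
    using c jt WA by auto
qed

lemma covers_A: "t \<in> {1..q} \<Longrightarrow> covers (A t) L"
  unfolding covers_iff_complement[OF L_subset] using not_L_if_avoids_A by blast

text \<open>
  Let \<open>t\<close> be the first position with \<open>j t \<notin> C\<close>. An element of \<open>C\<close> in \<open>A t\<close> would precede \<open>j t\<close>; together
  with \<open>j 1, \<dots>, j (t - 1)\<close> it would extend to a \<open>q\<close>-subset of \<open>C\<close> above \<open>V\<close>.
\<close>

lemma avoids_A_if_no_L:
  assumes C: "C \<subseteq> {2..n}" "q \<le> card C" and no_L: "\<And>W. W \<in> L \<Longrightarrow> \<not> W \<subseteq> C"
  shows "\<exists>t\<in>{1..q}. C \<inter> A t = {}"
proof -
  have "\<exists>t. t \<in> {1..q} \<and> j t \<notin> C"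
    using no_L[OF V_mem_L] by (auto simp: V_def)
  define t where "t = (LEAST t. t \<in> {1..q} \<and> j t \<notin> C)"
  have t: "t \<in> {1..q}" "j t \<notin> C"
    using LeastI_ex[OF \<open>\<exists>t. t \<in> {1..q} \<and> j t \<notin> C\<close>] by (auto simp: t_def)
  have before: "j s \<in> C" if "s \<in> {1..<t}" for s
    using not_less_Least[of s "\<lambda>t. t \<in> {1..q} \<and> j t \<notin> C"] that t by (auto simp: t_def)
  have "C \<inter> A t = {}"
  proof (rule ccontr)
    assume "C \<inter> A t \<noteq> {}"
    then obtain c where c: "c \<in> C" "c \<in> A t" by auto
    then have c_less: "c < j t" and c_new: "c \<notin> j ` {1..<t}"
      using t(2) by (auto simp: A_def le_less)
    have "c \<notin> V"
      using A_inter_V[OF t(1)] c c_less by (metis IntI less_irrefl singletonD)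
    have "card (insert c (j ` {1..<t})) \<le> Suc (card (j ` {1..<t}))"
      by (rule card_insert_le_m1) auto
    also have "\<dots> \<le> q"
      using card_image_le[of "{1..<t}" j] t(1) by auto
    finally have "\<exists>W. insert c (j ` {1..<t}) \<subseteq> W \<and> W \<subseteq> C \<and> card W = q"
      using C before c(1) finite_subset[OF C(1)] by (intro exists_subset_between) auto
    then obtain W where W: "insert c (j ` {1..<t}) \<subseteq> W" "W \<subseteq> C" "card W = q"
      by blast
    have "V \<inter> {..<c} \<subseteq> j ` {1..<t}"
      using c_less j_less_iff t(1) by (force simp: V_def)
    then have "V \<prec> W"
      using W(1) \<open>c \<notin> V\<close> by (auto simp: lex_less_def)
    then have "W \<in> L"
      using mem_L_without_one[of W] W C(1) by auto
    then show False
      using no_L W(2) by blast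
  qed
  with t(1) show ?thesis by blast
qed

lemma complement_A_eq:
  assumes t: "t \<in> {1..q}" and card: "card (A t) = n - q + 1"
  shows "{1..n} - A t = V - {j t}"
proof (rule sym, rule card_subset_eq)
  show "V - {j t} \<subseteq> {1..n} - A t"
    using A_inter_V[OF t] V(1) by auto
  have "finite (A t)" by (simp add: A_def)
  then have "card ({1..n} - A t) = n - (n - q + 1)"
    using card card_Diff_subset[OF _ A_subset[OF t]] by simp
  moreover have "card (V - {j t}) = q - 1"
    using A_inter_V[OF t] V by (subst card_Diff_singleton) auto
  ultimately show "card (V - {j t}) = card ({1..n} - A t)"
    using q_less_n q by simp
qed simp

end

text \<open>
  The assumption is what completeness says about the first shadow, see
  \<open>insert_one_contains_L_if_completely\<close>.
\<close>

locale completely_sqfree_lexsegment = sqfree_lexsegment +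
  assumes insert_one_contains_L:
    "\<And>B. B \<subseteq> {2..n} \<Longrightarrow> card B = q \<Longrightarrow> \<exists>W\<in>L. W \<subseteq> insert 1 B"
begin

lemma contains_L_if_large:
  assumes "1 \<in> C" and "C \<subseteq> {1..n}" and "q < card C"
  shows "\<exists>W\<in>L. W \<subseteq> C"
proof -
  have "finite C" using assms finite_subset by blast
  then have "q \<le> card (C - {1})"
    using assms by simp
  then obtain B where B: "B \<subseteq> C - {1}" "card B = q"
    by (meson obtain_subset_with_card_n)
  then have "B \<subseteq> {2..n}"
    using assms(2) by (intro subset_from_2) auto
  with B show ?thesis
    using insert_one_contains_L[of B] assms(1) by blast
qed

text \<open>
  Adding an index \<open>x \<noteq> 1\<close> of \<open>A t\<close> to the complement of \<open>A t\<close> creates a member of \<open>L\<close>: otherwise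
  the enlarged set would avoid some \<open>A s\<close>, a proper subset of \<open>A t\<close>, but the sets \<open>A s\<close> are
  pairwise incomparable.
\<close>

lemma min_cover_A:
  assumes t: "t \<in> {1..q}" and size: "q \<le> Suc (card ({1..n} - A t))"
    and one: "\<exists>W\<in>L. W \<subseteq> insert 1 ({1..n} - A t)"
  shows "A t \<in> min_covers n L"
  unfolding min_covers_iff_complement[OF L_subset]
proof (intro conjI ballI)
  show "A t \<subseteq> {1..n}" by (rule A_subset[OF t])
  show "\<not> (\<exists>W\<in>L. W \<subseteq> {1..n} - A t)"
    using not_L_if_avoids_A[OF t] by blast
  fix x assume x: "x \<in> A t"
  show "\<exists>W\<in>L. W \<subseteq> insert x ({1..n} - A t)"
  proof (rule ccontr)
    assume no: "\<not> ?thesis"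
    have "1 \<notin> {1..n} - A t"
      using one_mem_A[OF t] by simp
    moreover have "x \<noteq> 1" using no one by blast
    ultimately have "insert x ({1..n} - A t) \<subseteq> {2..n}"
      using x A_subset[OF t] by (intro subset_from_2) auto
    moreover have "q \<le> card (insert x ({1..n} - A t))"
      using x size by simp
    ultimately obtain s where s: "s \<in> {1..q}" "insert x ({1..n} - A t) \<inter> A s = {}"
      using avoids_A_if_no_L no by blast
    then have "A s \<subseteq> A t" "x \<notin> A s"
      using A_subset[OF s(1)] by auto
    then show False
      using A_subset_A[OF s(1) t] x by auto
  qed
qed

text \<open>
  The cases are whether \<open>1 \<in> C\<close> and whether \<open>C\<close>, the complement of \<open>G\<close>, has at least \<open>q\<close>
  elements.
\<close>

lemma min_covers_cases:
  assumes G: "G \<in> min_covers n L"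
  shows "(\<exists>t\<in>{1..q}. G = A t \<and> card (A t) \<le> n - q) \<or>
    (\<exists>t\<in>{1..q}. G = A t \<and> card (A t) = n - q + 1 \<and> V - {j t} \<preceq> F) \<or>
    (\<exists>C. G = {1..n} - C \<and> C \<subseteq> {2..n} \<and> card C = q - 1 \<and> (\<forall>t\<in>{1..q}. C \<inter> A t \<noteq> {}) \<and> C \<preceq> F) \<or>
    (G \<subseteq> {2..n} \<and> card G = n - q + 1 \<and> {2..n} - F \<preceq> G - {Min G}) \<or>
    (G \<subseteq> {2..n} \<and> card G = n - q \<and> U \<prec> {1..n} - G)"
proof -
  define C where "C = {1..n} - G"
  have G': "G \<subseteq> {1..n}" "\<And>W. W \<in> L \<Longrightarrow> \<not> W \<subseteq> C" "\<And>x. x \<in> G \<Longrightarrow> \<exists>W\<in>L. W \<subseteq> insert x C"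
    using G unfolding min_covers_iff_complement[OF L_subset] C_def by blast+
  have C: "C \<subseteq> {1..n}" "finite C" "finite G" "G = {1..n} - C"
    using G'(1) finite_subset[OF G'(1)] by (auto simp: C_def)
  have card_G: "card G = n - card C"
    using C card_Diff_subset[of C "{1..n}"] by simp
  have card_C: "card C \<le> n"
    using card_mono[OF _ C(1)] by simp
  \<comment> \<open>Fewer than \<open>q\<close> elements contain no edge, but any further element creates one, so only one element is missing.\<close>
  have small: "card C = q - 1 \<and> insert x C \<in> L" if less: "card C < q" and xG: "x \<in> G" for x
  proof -
    obtain W where W: "W \<in> L" "W \<subseteq> insert x C"
      using G'(3) xG by blast
    have x: "x \<notin> C" using xG C by auto
    have "card W = q" using W(1) by (simp add: L_def)
    moreover have "card W \<le> card (insert x C)"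
      using W(2) C by (simp add: card_mono)
    ultimately have "card C = q - 1" "card W = card (insert x C)"
      using less C x by auto
    then show ?thesis
      using card_subset_eq[of "insert x C" W] W C by auto
  qed
  show ?thesis
  proof (cases "1 \<in> C")
    case True
    then have G2: "G \<subseteq> {2..n}"
      using C by (intro subset_from_2) auto
    have "card C \<le> q"
      using contains_L_if_large[OF True C(1)] G'(2) by force
    then consider "card C = q" | "card C < q" by linarith
    then show ?thesis
    proof cases
      case 1
      have "V \<prec> C" using less_if_one_mem[OF True V(1)] .
      then have "\<not> C \<preceq> U"
        using G'(2)[of C] 1 C(1) by (auto simp: L_def)
      then have "U \<prec> C"
        using lex_less_linear[of C U] by auto
      then show ?thesis
        using G2 1 card_G by (auto simp: C_def)
    next
      case 2
      have "G \<noteq> {}"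
        using card_G 2 q_less_n by auto
      then have Min: "Min G \<in> G"
        using Min_in[OF C(3)] by simp
      have *: "card C = q - 1" "insert (Min G) C \<in> L"
        using small[OF 2 Min] by auto
      let ?D = "insert (Min G) (C - {1})"
      have "insert 1 ?D = insert (Min G) C"
        using True Min by auto
      have "Min G \<noteq> 1" "Min G \<in> {1..n}"
        using Min G2 C(4) by auto
      then have "?D \<subseteq> {2..n}"
        using C(1) by (intro subset_from_2) auto
      then have D: "?D \<preceq> F"
        using insert_one_mem_L[of ?D] * \<open>insert 1 ?D = _\<close> by simp
      have "G - {Min G} = {2..n} - ?D"
        using C True Min G2 by auto
      moreover have "{2..n} - F \<preceq> {2..n} - ?D"
        using D lex_less_Diff_iff[OF F(1) \<open>?D \<subseteq> {2..n}\<close>] by auto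
      ultimately have "{2..n} - F \<preceq> G - {Min G}"
        by metis
      moreover have "card G = n - q + 1"
        using card_G * q q_less_n by simp
      ultimately show ?thesis
        using G2 by blast
    qed
  next
    case False
    then have C2: "C \<subseteq> {2..n}" and one: "1 \<in> G"
      using C subset_from_2[OF C(1)] q_less_n by auto
    have A_case: "G = A t" if "t \<in> {1..q}" "C \<inter> A t = {}" for t
    proof (rule min_covers_subset_eq[OF G _ covers_A[OF that(1)]])
      show "A t \<subseteq> G"
        unfolding C(4) using that(2) A_subset[OF that(1)] by blast
    qed
    show ?thesis
    proof (cases "q \<le> card C")
      case True
      obtain t where t: "t \<in> {1..q}" "C \<inter> A t = {}"
        using avoids_A_if_no_L[OF C2 True G'(2)] by blast
      have "card (A t) \<le> n - q"
        using card_G True unfolding A_case[OF t] by linarith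
      then show ?thesis
        using A_case[OF t] t(1) by blast
    next
      case no: False
      then have *: "card C = q - 1" "insert 1 C \<in> L"
        using small[OF _ one] by auto
      then have CF: "C \<preceq> F"
        using insert_one_mem_L[OF C2] by simp
      show ?thesis
      proof (cases "\<exists>t\<in>{1..q}. C \<inter> A t = {}")
        case True
        then obtain t where t: "t \<in> {1..q}" "G = A t"
          using A_case by blast
        then have card_A: "card (A t) = n - q + 1"
          using card_G * q q_less_n by simp
        then have "C = V - {j t}"
          using complement_A_eq[OF t(1)] t(2) by (simp add: C_def)
        with CF have "V - {j t} \<preceq> F"
          by simp
        with t card_A have "\<exists>t\<in>{1..q}. G = A t \<and> card (A t) = n - q + 1 \<and> V - {j t} \<preceq> F"
          by (intro bexI[of _ t] conjI)
        then show ?thesis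
          by (rule disjI2[OF disjI1])
      next
        case False
        then have "\<forall>t\<in>{1..q}. C \<inter> A t \<noteq> {}"
          by simp
        with * CF C(4) C2 show ?thesis
          by (intro disjI2[OF disjI2[OF disjI1]] exI[of _ C] conjI)
      qed
    qed
  qed
qed

lemma min_cover_A_small:
  assumes t: "t \<in> {1..q}" and "card (A t) \<le> n - q"
  shows "A t \<in> min_covers n L"
proof (rule min_cover_A[OF t])
  have "finite (A t)" by (simp add: A_def)
  then have card: "q \<le> card ({1..n} - A t)"
    using assms q_less_n card_Diff_subset[OF _ A_subset[OF t]] by simp
  then show "q \<le> Suc (card ({1..n} - A t))" by simp
  show "\<exists>W\<in>L. W \<subseteq> insert 1 ({1..n} - A t)"
    using card one_mem_A[OF t] q_less_n by (intro contains_L_if_large) auto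
qed

lemma min_cover_A_large:
  assumes t: "t \<in> {1..q}" and card: "card (A t) = n - q + 1" and "V - {j t} \<preceq> F"
  shows "A t \<in> min_covers n L"
proof (rule min_cover_A[OF t])
  have card': "card (V - {j t}) = q - 1"
    using A_inter_V[OF t] V by (subst card_Diff_singleton) auto
  then show "q \<le> Suc (card ({1..n} - A t))"
    unfolding complement_A_eq[OF t card] by simp
  have "insert 1 (V - {j t}) \<in> L"
    using insert_one_mem_L[of "V - {j t}"] card' assms V(1) by auto
  then show "\<exists>W\<in>L. W \<subseteq> insert 1 ({1..n} - A t)"
    unfolding complement_A_eq[OF t card] by blast
qed

lemma min_cover_meeting_all_A:
  assumes C: "C \<subseteq> {2..n}" "card C = q - 1" and meets: "\<forall>t\<in>{1..q}. C \<inter> A t \<noteq> {}" and "C \<preceq> F"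
  shows "{1..n} - C \<in> min_covers n L"
  unfolding min_covers_iff_complement[OF L_subset]
proof (intro conjI ballI)
  have "C \<subseteq> {1..n}"
    using C(1) by auto
  then have C': "{1..n} - ({1..n} - C) = C" "finite C"
    using finite_subset[OF C(1)] double_diff[of C "{1..n}" "{1..n}"] by simp_all
  show "\<not> (\<exists>W\<in>L. W \<subseteq> {1..n} - ({1..n} - C))"
    unfolding C' using not_L_if_small[OF C'(2)] C(2) q by auto
  fix x assume x: "x \<in> {1..n} - C"
  show "\<exists>W\<in>L. W \<subseteq> insert x ({1..n} - ({1..n} - C))"
    unfolding C'
  proof (cases "x = 1")
    case True
    then show "\<exists>W\<in>L. W \<subseteq> insert x C"
      using insert_one_mem_L[OF C(1)] assms by blast
  next
    case False
    then have "insert x C \<subseteq> {2..n}" "q \<le> card (insert x C)"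
      using x C C' by auto
    then show "\<exists>W\<in>L. W \<subseteq> insert x C"
      using avoids_A_if_no_L[of "insert x C"] meets by blast
  qed
qed simp

text \<open>
  Complementation reverses the order, so the hypothesis says that \<open>D\<close> with \<open>Min G\<close> added is at
  most \<open>F\<close>, where \<open>D\<close> is the complement of \<open>G\<close> in \<open>{2..n}\<close>. Adding a larger index of \<open>G\<close> instead
  gives a smaller set in the order.
\<close>

lemma min_cover_without_one_large:
  assumes G: "G \<subseteq> {2..n}" "card G = n - q + 1" and less: "{2..n} - F \<preceq> G - {Min G}"
  shows "G \<in> min_covers n L"
  unfolding min_covers_iff_complement[OF L_subset]
proof (intro conjI ballI)
  define D where "D = {2..n} - G"
  have D: "{1..n} - G = insert 1 D" "D \<subseteq> {2..n}" "finite D" "1 \<notin> D"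
    using G(1) q_less_n by (auto simp: D_def)
  have fin: "finite G" using G finite_subset by blast
  have card_D: "card D = q - 2"
    using G q_less_n fin q by (simp add: D_def card_Diff_subset)
  show "G \<subseteq> {1..n}" using G by auto
  show "\<not> (\<exists>W\<in>L. W \<subseteq> {1..n} - G)"
    unfolding D(1) using not_L_if_small[of "insert 1 D"] D(3,4) card_D q by auto
  fix x assume x: "x \<in> G"
  then have Min: "Min G \<in> G" "Min G \<le> x"
    using Min_in[OF fin] Min_le[OF fin x] by auto
  have "G - {Min G} = {2..n} - insert (Min G) D"
    using G Min by (auto simp: D_def)
  moreover have *: "insert (Min G) D \<subseteq> {2..n}" "insert x D \<subseteq> {2..n}"
    using G Min x by (auto simp: D_def)
  ultimately have Min_F: "insert (Min G) D \<preceq> F"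
    using less lex_less_Diff_iff[OF F(1) *(1)] F(1) by (metis double_diff order_refl)
  have "insert x D \<preceq> insert (Min G) D"
  proof (cases "x = Min G")
    case False
    then have "insert x D \<prec> insert (Min G) D"
      unfolding lex_less_def
      using Min by (intro bexI[of _ "Min G"]) (auto simp: D_def)
    then show ?thesis by simp
  qed simp
  with Min_F have "insert x D \<preceq> F"
    using lex_less_trans by metis
  moreover have "card (insert x D) = q - 1"
    using D card_D x q by (simp add: D_def)
  ultimately have "insert 1 (insert x D) \<in> L"
    using insert_one_mem_L[OF *(2)] by simp
  then show "\<exists>W\<in>L. W \<subseteq> insert x ({1..n} - G)"
    unfolding D by (auto simp: insert_commute)
qed

lemma min_cover_without_one_small:
  assumes G: "G \<subseteq> {2..n}" "card G = n - q" and less: "U \<prec> {1..n} - G"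
  shows "G \<in> min_covers n L"
  unfolding min_covers_iff_complement[OF L_subset]
proof (intro conjI ballI)
  have fin: "finite G" using G finite_subset by blast
  show sub: "G \<subseteq> {1..n}" using G by auto
  have card: "card ({1..n} - G) = q"
    using G q_less_n fin sub by (simp add: card_Diff_subset)
  show "\<not> (\<exists>W\<in>L. W \<subseteq> {1..n} - G)"
  proof
    assume "\<exists>W\<in>L. W \<subseteq> {1..n} - G"
    then obtain W where "W \<in> L" "W \<subseteq> {1..n} - G" by blast
    then have "{1..n} - G \<in> L"
      using card card_subset_eq[of "{1..n} - G" W] by (simp add: L_def)
    then show False
      using lex_less_asym[OF less] by (auto simp: L_def)
  qed
  fix x assume "x \<in> G"
  then show "\<exists>W\<in>L. W \<subseteq> insert x ({1..n} - G)"
    using sub G(1) card q_less_n by (intro contains_L_if_large) auto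
qed

end

context sqfree_lexsegment
begin

text \<open>
  All \<open>q\<close>-subsets of \<open>{2..n}\<close> are in \<open>Lf\<close>, so every cover of \<open>Lf\<close> contains at least \<open>n - q\<close> elements
  of \<open>{2..n}\<close>. This excludes \<open>1\<close> from a cover of size \<open>n - q\<close> and makes such covers minimal.
\<close>

lemma min_covers_final_small:
  "{G \<in> min_covers n Lf. card G = n - q} = {G. G \<subseteq> {2..n} \<and> card G = n - q \<and> U \<prec> {1..n} - G}"
    (is "?L = ?R")
proof -
  have sub: "Lf \<subseteq> Pow {1..n}" by (auto simp: Lf_def)
  have edge: "\<exists>W\<in>Lf. W \<subseteq> C" if "C \<subseteq> {2..n}" "q \<le> card C" for C
  proof -
    obtain W where "W \<subseteq> C" "card W = q"
      using obtain_subset_with_card_n[OF \<open>q \<le> card C\<close>] .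
    then show ?thesis
      using that less_U[of W] by (intro bexI[of _ W]) (auto simp: Lf_def)
  qed
  show ?thesis
  proof (intro equalityI subsetI)
    fix G assume "G \<in> ?L"
    then have G: "G \<subseteq> {1..n}" "card G = n - q" and no: "\<not> (\<exists>W\<in>Lf. W \<subseteq> {1..n} - G)"
      unfolding min_covers_iff_complement[OF sub] by blast+
    have fin: "finite G" using G finite_subset by blast
    have card: "card ({1..n} - G) = q"
      using G fin q_less_n by (simp add: card_Diff_subset)
    have "1 \<notin> G"
    proof
      assume "1 \<in> G"
      then have "{1..n} - G \<subseteq> {2..n}" by (intro subset_from_2) auto
      then show False
        using edge card no by blast
    qed
    then have "G \<subseteq> {2..n}"
      using G(1) by (intro subset_from_2)
    moreover have "\<not> {1..n} - G \<preceq> U"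
      using no card by (auto simp: Lf_def)
    then have "U \<prec> {1..n} - G"
      using lex_less_linear by blast
    ultimately show "G \<in> ?R"
      using G by simp
  next
    fix G assume "G \<in> ?R"
    then have G: "G \<subseteq> {2..n}" "card G = n - q" and less: "U \<prec> {1..n} - G"
      by auto
    have fin: "finite G" using G finite_subset by blast
    have sub1: "G \<subseteq> {1..n}" using G by auto
    have card: "card ({1..n} - G) = q"
      using G q_less_n fin sub1 by (simp add: card_Diff_subset)
    have "\<not> (\<exists>W\<in>Lf. W \<subseteq> {1..n} - G)"
    proof
      assume "\<exists>W\<in>Lf. W \<subseteq> {1..n} - G"
      then obtain W where "W \<in> Lf" "W \<subseteq> {1..n} - G" by blast
      then have "{1..n} - G \<in> Lf"
        using card card_subset_eq[of "{1..n} - G" W] by (simp add: Lf_def)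
      then show False
        using lex_less_asym[OF less] by (auto simp: Lf_def)
    qed
    moreover have "\<exists>W\<in>Lf. W \<subseteq> insert x ({1..n} - G)" if x: "x \<in> G" for x
    proof -
      have "card ({2..n} - G) = q - 1"
        using G q_less_n fin by (simp add: card_Diff_subset)
      then have "q \<le> card (insert x ({2..n} - G))"
        using x by simp
      moreover have "insert x ({2..n} - G) \<subseteq> {2..n}"
        using x G(1) by blast
      ultimately obtain W where "W \<in> Lf" "W \<subseteq> insert x ({2..n} - G)"
        using edge by blast
      then show ?thesis
        by (intro bexI[of _ W]) auto
    qed
    ultimately show "G \<in> ?L"
      unfolding mem_Collect_eq min_covers_iff_complement[OF sub] using sub1 G by blast
  qed
qed

end

lemma (in completely_sqfree_lexsegment) min_covers_L:
  "min_covers n L =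
    {A t | t. t \<in> {1..q} \<and> card (A t) \<le> n - q} \<union>
    {A t | t. t \<in> {1..q} \<and> card (A t) = n - q + 1 \<and> V - {j t} \<preceq> F} \<union>
    {{1..n} - C | C. C \<subseteq> {2..n} \<and> card C = q - 1 \<and> (\<forall>t\<in>{1..q}. C \<inter> A t \<noteq> {}) \<and> C \<preceq> F} \<union>
    {G. G \<subseteq> {2..n} \<and> card G = n - q + 1 \<and> {2..n} - F \<preceq> G - {Min G}} \<union>
    {G \<in> min_covers n Lf. card G = n - q}"
  (is "_ = ?R1 \<union> ?R2 \<union> ?R3 \<union> ?R4 \<union> ?R5")
proof (intro equalityI Un_least subsetI)
  fix G assume "G \<in> min_covers n L"
  from min_covers_cases[OF this] show "G \<in> ?R1 \<union> ?R2 \<union> ?R3 \<union> ?R4 \<union> ?R5"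
    unfolding min_covers_final_small Un_iff mem_Collect_eq
    by (elim disjE) blast+
next
  fix G assume "G \<in> ?R5"
  then show "G \<in> min_covers n L"
    unfolding min_covers_final_small using min_cover_without_one_small by simp
qed (use min_cover_A_small min_cover_A_large min_cover_meeting_all_A min_cover_without_one_large
      in \<open>auto simp del: One_nat_def\<close>)


section \<open>Squarefree monomials as sets of indices\<close>

lemma mon_of_set_less_iff:
  assumes "finite A" and "finite B"
  shows "mon_of_set A < mon_of_set B \<longleftrightarrow> A \<prec> B"
  unfolding less_poly_mapping.rep_eq less_fun_def lex_less_iff_first_difference
    lookup_mon_of_set[OF assms(1)] lookup_mon_of_set[OF assms(2)]
  by (auto split: if_splits)

lemma mon_of_set_eq_iff:
  assumes "finite A" and "finite B"
  shows "mon_of_set A = mon_of_set B \<longleftrightarrow> A = B"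
  using keys_mon_of_set[OF assms(1)] keys_mon_of_set[OF assms(2)] by metis

lemma mon_of_set_le_iff:
  assumes "finite A" and "finite B"
  shows "mon_of_set A \<le> mon_of_set B \<longleftrightarrow> A \<preceq> B"
  by (simp add: le_less mon_of_set_less_iff mon_of_set_eq_iff assms)

lemma mon_of_set_insert: "finite G \<Longrightarrow> i \<notin> G \<Longrightarrow> mon_of_set (insert i G) = X i + mon_of_set G"
  by (simp add: mon_of_set_def)

lemma sqfree_mons_eq: "sqfree_mons n d = mon_of_set ` {W. W \<subseteq> {1..n} \<and> card W = d}"
proof (intro equalityI subsetI)
  fix w assume w: "w \<in> sqfree_mons n d"
  have "w = mon_of_set (Poly_Mapping.keys w)"
  proof (rule poly_mapping_eqI)
    fix i
    have "Poly_Mapping.lookup w i \<le> 1" using w by (simp add: sqfree_mons_def)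
    then show "Poly_Mapping.lookup w i = Poly_Mapping.lookup (mon_of_set (Poly_Mapping.keys w)) i"
      by (auto simp: lookup_mon_of_set in_keys_iff)
  qed
  moreover have "card (Poly_Mapping.keys w) = d"
  proof -
    have "Poly_Mapping.lookup w i = 1" if "i \<in> Poly_Mapping.keys w" for i
    proof -
      have "Poly_Mapping.lookup w i \<le> 1" using w by (simp add: sqfree_mons_def)
      then show ?thesis using that by (simp add: in_keys_iff)
    qed
    then show ?thesis
      using w by (simp add: sqfree_mons_def)
  qed
  ultimately show "w \<in> mon_of_set ` {W. W \<subseteq> {1..n} \<and> card W = d}"
    using w by (auto simp: sqfree_mons_def)
next
  fix w assume "w \<in> mon_of_set ` {W. W \<subseteq> {1..n} \<and> card W = d}"
  then obtain W where W: "W \<subseteq> {1..n}" "card W = d" "w = mon_of_set W" by blast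
  then have "finite W" using finite_subset by blast
  then show "w \<in> sqfree_mons n d"
    using W by (simp add: sqfree_mons_def lookup_mon_of_set)
qed

lemma mon_of_set_le_iff_bounded:
  assumes "A \<subseteq> {1..n}" and "B \<subseteq> {1..n}"
  shows "mon_of_set A \<le> mon_of_set B \<longleftrightarrow> A \<preceq> B"
  by (rule mon_of_set_le_iff) (use assms finite_subset in blast)+

lemma lexseg_mon_of_set:
  assumes "A \<subseteq> {1..n}" and "B \<subseteq> {1..n}"
  shows "lexseg n d (mon_of_set A) (mon_of_set B) =
    mon_of_set ` {W. W \<subseteq> {1..n} \<and> card W = d \<and> B \<preceq> W \<and> W \<preceq> A}"
  unfolding lexseg_def sqfree_mons_eq
  using mon_of_set_le_iff_bounded[OF _ assms(1)] mon_of_set_le_iff_bounded[OF assms(2)] by blast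

lemma final_lexseg_mon_of_set:
  assumes "A \<subseteq> {1..n}"
  shows "final_lexseg n d (mon_of_set A) = mon_of_set ` {W. W \<subseteq> {1..n} \<and> card W = d \<and> W \<preceq> A}"
  unfolding final_lexseg_def sqfree_mons_eq
  using mon_of_set_le_iff_bounded[OF _ assms] by blast

lemma mem_sqfree_shadow_iff:
  assumes E: "E \<subseteq> Pow {1..n}" and T: "finite T"
  shows "mon_of_set T \<in> sqfree_shadow n (mon_of_set ` E) \<longleftrightarrow> (\<exists>W\<in>E. \<exists>i\<in>{1..n} - W. T = insert i W)"
proof -
  have fin: "finite W" if "W \<in> E" for W
    using that E finite_subset[of W "{1..n}"] by auto
  have "mon_of_set T = X i + mon_of_set W \<longleftrightarrow> T = insert i W" if "W \<in> E" "i \<notin> W" for i W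
    using mon_of_set_insert[OF fin[OF that(1)] that(2)] mon_of_set_eq_iff[OF T, of "insert i W"] fin[OF that(1)]
    by simp
  moreover have "Poly_Mapping.keys (mon_of_set W) = W" if "W \<in> E" for W
    by (rule keys_mon_of_set[OF fin[OF that]])
  ultimately have "(mon_of_set T = X i + mon_of_set W \<and> i \<in> {1..n} \<and> i \<notin> Poly_Mapping.keys (mon_of_set W)) \<longleftrightarrow>
      (i \<in> {1..n} - W \<and> T = insert i W)" if "W \<in> E" for i W
    using that by auto
  then show ?thesis
    unfolding sqfree_shadow_def by blast
qed

context sqfree_lexsegment
begin

text \<open>
  The first shadow is an interval of \<open>(q+1)\<close>-sets, so it is enough to place \<open>insert 1 B\<close> between
  two of its members. Below it lies \<open>insert y V\<close> with \<open>y \<noteq> 1\<close>, which lacks \<open>1\<close>; above it lies the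
  largest \<open>(q+1)\<close>-set \<open>{1..q + 1}\<close>, obtained from \<open>{2..q + 1} \<in> L\<close>.
\<close>

lemma insert_one_contains_L_if_completely:
  assumes comp: "completely_sqfree_lexseg n q (mon_of_set ` L)"
    and B: "B \<subseteq> {2..n}" "card B = q"
  shows "\<exists>W\<in>L. W \<subseteq> insert 1 B"
proof (cases "B = V")
  case True
  then show ?thesis using V_mem_L by blast
next
  case False
  have fin: "finite W" if "W \<subseteq> {1..n}" for W
    using that finite_subset by blast
  have finB: "finite B" using finite_subset[OF B(1)] by simp
  have finV: "finite V" using finite_subset[OF V(1)] by simp
  have "1 \<le> n - q" using q_less_n by simp
  then have "is_sqfree_lexseg n (q + 1) (sqfree_shadow n (mon_of_set ` L))"
    using comp unfolding completely_sqfree_lexseg_def by (auto dest: spec[of _ 1])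
  then obtain a b where ab: "a \<subseteq> {1..n}" "b \<subseteq> {1..n}"
      "sqfree_shadow n (mon_of_set ` L) = lexseg n (q + 1) (mon_of_set a) (mon_of_set b)"
    unfolding is_sqfree_lexseg_def sqfree_mons_eq by blast
  have shadow_iff: "(\<exists>W\<in>L. \<exists>i\<in>{1..n} - W. T = insert i W) \<longleftrightarrow> b \<preceq> T \<and> T \<preceq> a"
    if T: "T \<subseteq> {1..n}" "card T = q + 1" for T
  proof -
    have "(\<exists>W\<in>L. \<exists>i\<in>{1..n} - W. T = insert i W) \<longleftrightarrow> mon_of_set T \<in> sqfree_shadow n (mon_of_set ` L)"
      using mem_sqfree_shadow_iff[OF L_subset fin[OF T(1)]] by simp
    also have "\<dots> \<longleftrightarrow> b \<preceq> T \<and> T \<preceq> a"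
      unfolding ab(3) lexseg_mon_of_set[OF ab(1,2)]
      using T mon_of_set_eq_iff fin by (auto simp: image_iff)
    finally show ?thesis .
  qed
  have "\<not> B \<subseteq> V"
    using False card_subset_eq[OF finV] B(2) V(2) by auto
  then obtain y where y: "y \<in> B" "y \<notin> V" by blast
  have "y \<in> {1..n}"
    using y(1) B(1) by auto
  then have "insert y V \<subseteq> {1..n}" "card (insert y V) = q + 1" "y \<in> {1..n} - V"
    using y(2) V finV by auto
  then have "b \<preceq> insert y V"
    using shadow_iff[of "insert y V"] V_mem_L by blast
  moreover have "insert y V \<prec> insert 1 B"
    using y(1) V(1) B(1) by (intro less_if_one_mem) auto
  ultimately have lower: "b \<preceq> insert 1 B"
    using lex_less_trans by metis
  have "V \<preceq> {2..q + 1}"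
    by (rule lex_le_interval[OF _ finV]) (use V in auto)
  moreover have "{2..q + 1} \<subseteq> {2..n}"
    using q_less_n by simp
  ultimately have "{2..q + 1} \<in> L"
    using mem_L_without_one by simp
  moreover have "{1..q + 1} = insert 1 {2..q + 1}" by auto
  moreover have "{1..q + 1} \<subseteq> {1..n}" "card {1..q + 1} = q + 1" "1 \<in> {1..n} - {2..q + 1}"
    using q_less_n by auto
  ultimately have "{1..q + 1} \<preceq> a"
    using shadow_iff[of "{1..q + 1}"] by blast
  moreover have card: "card (insert 1 B) = q + 1"
    using B finB by (subst card_insert_disjoint) auto
  moreover have "insert 1 B \<preceq> {1..q + 1}"
    using card B finB by (intro lex_le_interval) auto
  ultimately have upper: "insert 1 B \<preceq> a"
    using lex_less_trans by metis
  have sub: "insert 1 B \<subseteq> {1..n}"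
    using B(1) q_less_n by auto
  obtain W i where "W \<in> L" "insert 1 B = insert i W"
    using iffD2[OF shadow_iff[OF sub card] conjI[OF lower upper]] by blast
  then show ?thesis by blast
qed

end


section \<open>The primary decomposition\<close>

text \<open>
  With \<open>I\<close> written as the ideal of \<open>L\<close>, each family of primes in the statement is the image under
  \<open>P n\<close> of the corresponding family of minimal covers of \<open>L\<close>. When \<open>2 \<notin> F\<close> the fourth family of
  covers is empty: \<open>2\<close> belongs to \<open>{2..n} - F\<close> but to no \<open>G - {Min G}\<close>.
\<close>

theorem theorem2p1p11:
  fixes n q :: nat and F :: "nat set" and j :: "nat \<Rightarrow> nat"
    and u v :: mon and A :: "nat \<Rightarrow> nat set"
    and I :: "(mon \<Rightarrow>\<^sub>0 'k::field) set"
  assumes "2 \<le> q"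
    and "F \<subseteq> {2..n}" and "card F = q - 1"
    and u: "u = X 1 + mon_of_set F"
    and "strict_mono_on {1..q} j" and "j ` {1..q} \<subseteq> {2..n}"
    and v: "v = (\<Sum>t = 1..q. X (j t))"
    and "completely_sqfree_lexseg n q (lexseg n q u v)"
    and I: "I = mon_ideal n (lexseg n q u v)"
    and A: "\<And>t. A t = {1..j t} - j ` {1..<t}"
  shows
    "(2 \<notin> Poly_Mapping.keys u \<longrightarrow>
       minimal_primary_decomposition (S n) I
        ({P n (A t) | t. t \<in> {1..q} \<and> card (A t) \<le> n - q}
         \<union> {P n (A t) | t. t \<in> {1..q} \<and> card (A t) = n - q + 1 \<and> v - X (j t) \<le> u - X 1}
         \<union> {P n ({1..n} - G) | G. G \<subseteq> {1..n} \<and> card G = q - 1 \<and>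
              (\<forall>t\<in>{1..q}. G \<inter> A t \<noteq> {}) \<and> mon_of_set G \<le> u - X 1}
         \<union> {Q \<in> minimal_primes (S n) (mon_ideal n (final_lexseg n q u)).
              height (S n) Q = enat (n - q)})) \<and>
     (2 \<in> Poly_Mapping.keys u \<longrightarrow>
       minimal_primary_decomposition (S n) I
        ({P n (A t) | t. t \<in> {1..q} \<and> card (A t) \<le> n - q}
         \<union> {P n (A t) | t. t \<in> {1..q} \<and> card (A t) = n - q + 1 \<and> v - X (j t) \<le> u - X 1}
         \<union> {P n ({1..n} - G) | G. G \<subseteq> {1..n} - {1} \<and> card G = q - 1 \<and>
              (\<forall>t\<in>{1..q}. G \<inter> A t \<noteq> {}) \<and> mon_of_set G \<le> u - X 1}
         \<union> {P n G | G. G \<subseteq> {1..n} - {1} \<and> card G = n - q + 1 \<and>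
              mon_of_set ({1..n} - F - {1}) \<le> mon_of_set (G - {Min G})}
         \<union> {Q \<in> minimal_primes (S n) (mon_ideal n (final_lexseg n q u)).
              height (S n) Q = enat (n - q)}))"
proof -
  interpret lex: sqfree_lexsegment n q F j
    by (rule sqfree_lexsegment.intro) (fact assms)+
  have fin: "finite W" if "W \<subseteq> {1..n}" for W :: "nat set"
    using that finite_subset by blast
  have sub: "F \<subseteq> {1..n}" "lex.V \<subseteq> {1..n}" "lex.U \<subseteq> {1..n}"
    using assms(2) lex.V(1) lex.q_less_n by (auto simp: lex.U_def)
  have "1 \<notin> F" using assms(2) by auto
  then have u_eq: "u = mon_of_set lex.U"
    unfolding u lex.U_def using fin[OF sub(1)] by (simp add: mon_of_set_insert)
  have v_eq: "v = mon_of_set lex.V"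
    unfolding v lex.V_def mon_of_set_def
    by (simp only: sum.reindex[OF strict_mono_on_imp_inj_on[OF assms(5)]] comp_def)
  have A_eq: "A = lex.A"
    by (rule ext) (simp add: A lex.A_def)
  have L_eq: "lexseg n q u v = mon_of_set ` lex.L"
    unfolding u_eq v_eq lexseg_mon_of_set[OF sub(3,2)] lex.L_def ..
  have Lf_eq: "final_lexseg n q u = mon_of_set ` lex.Lf"
    unfolding u_eq final_lexseg_mon_of_set[OF sub(3)] lex.Lf_def ..
  have Lf_sub: "lex.Lf \<subseteq> Pow {1..n}"
    by (auto simp: lex.Lf_def)
  interpret lex: completely_sqfree_lexsegment n q F j
    by unfold_locales
      (use lex.insert_one_contains_L_if_completely assms(8) in \<open>simp add: L_eq\<close>)
  have u1: "u - X 1 = mon_of_set F"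
    by (simp add: u)
  have vt: "v - X (j t) \<le> u - X 1 \<longleftrightarrow> lex.V - {j t} \<preceq> F" if "t \<in> {1..q}" for t
  proof -
    have "j t \<in> lex.V" using that by (simp add: lex.V_def)
    then have "v = X (j t) + mon_of_set (lex.V - {j t})"
      unfolding v_eq mon_of_set_def using sum.remove[OF fin[OF sub(2)]] by blast
    then have "v - X (j t) = mon_of_set (lex.V - {j t})"
      by simp
    then show ?thesis
      unfolding u1 using mon_of_set_le_iff[of "lex.V - {j t}" F] fin sub by simp
  qed
  have F_le: "mon_of_set G \<le> u - X 1 \<longleftrightarrow> G \<preceq> F" if "G \<subseteq> {1..n}" for G
    unfolding u1 using mon_of_set_le_iff fin sub(1) that by simp
  have from_2: "G \<subseteq> {1..n} - {1} \<longleftrightarrow> G \<subseteq> {2..n}" for G :: "nat set"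
    using subset_from_2[of G n] by auto
  have F_compl: "{1..n} - F - {1} = {2..n} - F"
    by auto
  have fourth_le: "mon_of_set ({1..n} - F - {1}) \<le> mon_of_set (G - {Min G}) \<longleftrightarrow> {2..n} - F \<preceq> G - {Min G}"
    if "G \<subseteq> {2..n}" for G
    unfolding F_compl using that finite_subset[OF that] by (intro mon_of_set_le_iff) auto
  \<comment> \<open>A set at most \<open>F\<close> misses \<open>1\<close>, so the two descriptions of the third family agree.\<close>
  have without_one: "G \<subseteq> {1..n} \<and> G \<preceq> F \<longleftrightarrow> G \<subseteq> {2..n} \<and> G \<preceq> F" for G
  proof -
    have "1 \<notin> G" if "G \<preceq> F"
      using that lex_less_asym[OF lex.less_if_one_mem[OF _ assms(2)], of G] by blast
    then show ?thesis
      using subset_from_2[of G n] by auto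
  qed
  have decomp: "minimal_primary_decomposition (S n) I (P n ` min_covers n lex.L)"
    unfolding I L_eq by (rule minimal_primary_decomposition_mon_ideal[OF lex.L_subset])
  have R1: "{P n (A t) | t. t \<in> {1..q} \<and> card (A t) \<le> n - q} =
      (P n ` {lex.A t | t. t \<in> {1..q} \<and> card (lex.A t) \<le> n - q} :: (mon \<Rightarrow>\<^sub>0 'k) set set)"
    unfolding A_eq by blast
  have R2: "{P n (A t) | t. t \<in> {1..q} \<and> card (A t) = n - q + 1 \<and> v - X (j t) \<le> u - X 1} =
      (P n ` {lex.A t | t. t \<in> {1..q} \<and> card (lex.A t) = n - q + 1 \<and> lex.V - {j t} \<preceq> F}
        :: (mon \<Rightarrow>\<^sub>0 'k) set set)"
    unfolding A_eq using vt by blast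
  let ?C = "{{1..n} - C | C. C \<subseteq> {2..n} \<and> card C = q - 1 \<and> (\<forall>t\<in>{1..q}. C \<inter> lex.A t \<noteq> {}) \<and> C \<preceq> F}"
  have R3: "{P n ({1..n} - G) | G. G \<subseteq> {1..n} \<and> card G = q - 1 \<and>
        (\<forall>t\<in>{1..q}. G \<inter> A t \<noteq> {}) \<and> mon_of_set G \<le> u - X 1} = (P n ` ?C :: (mon \<Rightarrow>\<^sub>0 'k) set set)"
  proof -
    have "G \<subseteq> {1..n} \<and> card G = q - 1 \<and> (\<forall>t\<in>{1..q}. G \<inter> A t \<noteq> {}) \<and> mon_of_set G \<le> u - X 1 \<longleftrightarrow>
        G \<subseteq> {2..n} \<and> card G = q - 1 \<and> (\<forall>t\<in>{1..q}. G \<inter> lex.A t \<noteq> {}) \<and> G \<preceq> F" for G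
      unfolding A_eq using F_le[of G] without_one[of G] by blast
    then show ?thesis by auto
  qed
  have R3': "{P n ({1..n} - G) | G. G \<subseteq> {1..n} - {1} \<and> card G = q - 1 \<and>
        (\<forall>t\<in>{1..q}. G \<inter> A t \<noteq> {}) \<and> mon_of_set G \<le> u - X 1} = (P n ` ?C :: (mon \<Rightarrow>\<^sub>0 'k) set set)"
  proof -
    have "G \<subseteq> {1..n} - {1} \<and> card G = q - 1 \<and> (\<forall>t\<in>{1..q}. G \<inter> A t \<noteq> {}) \<and> mon_of_set G \<le> u - X 1 \<longleftrightarrow>
        G \<subseteq> {2..n} \<and> card G = q - 1 \<and> (\<forall>t\<in>{1..q}. G \<inter> lex.A t \<noteq> {}) \<and> G \<preceq> F" for G
    proof -
      have "mon_of_set G \<le> u - X 1 \<longleftrightarrow> G \<preceq> F" if "G \<subseteq> {2..n}"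
        by (rule F_le) (use that in auto)
      then show ?thesis
        unfolding A_eq from_2 by blast
    qed
    then show ?thesis by auto
  qed
  let ?G = "{G. G \<subseteq> {2..n} \<and> card G = n - q + 1 \<and> {2..n} - F \<preceq> G - {Min G}}"
  have R4: "{P n G | G. G \<subseteq> {1..n} - {1} \<and> card G = n - q + 1 \<and>
        mon_of_set ({1..n} - F - {1}) \<le> mon_of_set (G - {Min G})} = (P n ` ?G :: (mon \<Rightarrow>\<^sub>0 'k) set set)"
    unfolding from_2 using fourth_le by blast
  have R5: "{Q \<in> minimal_primes (S n) (mon_ideal n (final_lexseg n q u)). height (S n) Q = enat (n - q)} =
      (P n ` {G \<in> min_covers n lex.Lf. card G = n - q} :: (mon \<Rightarrow>\<^sub>0 'k) set set)"
    unfolding Lf_eq minimal_primes_mon_ideal[OF Lf_sub]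
    using height_P[OF min_covers_subset, where ?'k = 'k] by auto
  have G_empty: "?G = {}" if "2 \<notin> Poly_Mapping.keys u"
  proof -
    have "2 \<notin> F"
      using that fin[OF sub(3)] by (simp add: u_eq lex.U_def)
    have False if G: "G \<subseteq> {2..n}" "card G = n - q + 1" "{2..n} - F \<preceq> G - {Min G}" for G
    proof -
      have "finite G" using finite_subset[OF G(1)] by simp
      have "2 \<notin> G - {Min G}"
      proof
        assume "2 \<in> G - {Min G}"
        then have "2 \<in> G" "2 \<noteq> Min G" by auto
        then have "Min G \<in> G" "Min G \<le> 2"
          using \<open>finite G\<close> by (auto intro: Min_in)
        then show False
          using G(1) \<open>2 \<noteq> Min G\<close> by auto
      qed
      moreover have two: "2 \<in> {2..n} - F"
        using \<open>2 \<notin> F\<close> lex.q_less_n assms(1) by simp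
      ultimately have "G - {Min G} \<prec> {2..n} - F"
        unfolding lex_less_def using G(1) by (intro bexI[of _ 2]) auto
      then show False
        using lex_less_asym G(3) by blast
    qed
    then show ?thesis by blast
  qed
  show ?thesis
  proof (intro conjI impI)
    assume two: "2 \<notin> Poly_Mapping.keys u"
    show "minimal_primary_decomposition (S n) I
        ({P n (A t) | t. t \<in> {1..q} \<and> card (A t) \<le> n - q}
         \<union> {P n (A t) | t. t \<in> {1..q} \<and> card (A t) = n - q + 1 \<and> v - X (j t) \<le> u - X 1}
         \<union> {P n ({1..n} - G) | G. G \<subseteq> {1..n} \<and> card G = q - 1 \<and>
              (\<forall>t\<in>{1..q}. G \<inter> A t \<noteq> {}) \<and> mon_of_set G \<le> u - X 1}
         \<union> {Q \<in> minimal_primes (S n) (mon_ideal n (final_lexseg n q u)).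
              height (S n) Q = enat (n - q)})"
      using decomp unfolding lex.min_covers_L G_empty[OF two] image_Un R1 R2 R3 R5
      by (simp only: image_empty Un_empty_right)
  next
    show "minimal_primary_decomposition (S n) I
        ({P n (A t) | t. t \<in> {1..q} \<and> card (A t) \<le> n - q}
         \<union> {P n (A t) | t. t \<in> {1..q} \<and> card (A t) = n - q + 1 \<and> v - X (j t) \<le> u - X 1}
         \<union> {P n ({1..n} - G) | G. G \<subseteq> {1..n} - {1} \<and> card G = q - 1 \<and>
              (\<forall>t\<in>{1..q}. G \<inter> A t \<noteq> {}) \<and> mon_of_set G \<le> u - X 1}
         \<union> {P n G | G. G \<subseteq> {1..n} - {1} \<and> card G = n - q + 1 \<and>
              mon_of_set ({1..n} - F - {1}) \<le> mon_of_set (G - {Min G})}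
         \<union> {Q \<in> minimal_primes (S n) (mon_ideal n (final_lexseg n q u)).
              height (S n) Q = enat (n - q)})"
      using decomp unfolding lex.min_covers_L image_Un R1 R2 R3' R4 R5 .
  qed
qed

end
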